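(* Let $1<r<\infty$ and let $w=uv^{1/r}$ be a weight on $\mathbb{R}$ in $RH_r$ with $u\in RH_\infty$ and $v\in A_1$. If $c_2=A_1(v)$, then $w\in RH_p$ for all $r\le p<\frac{c_2 r}{c_2-1}$ (the upper bound being read as $\infty$ if $c_2=1$). Moreover, this range of $p$'s is best possible on $\mathbb{R}_+$: for every $1<r<\infty$ and every $c_2>1$ there are weights $u\in RH_\infty$ and $v\in A_1$ on $\mathbb{R}_+$ with $A_1(v)=c_2$ and $w=uv^{1/r}\in RH_r$ (all conditions taken over intervals $I\subset\mathbb{R}_+$) such that $w\notin RH_p$ on $\mathbb{R}_+$ for every $p\ge\frac{c_2 r}{c_2-1}$.
   Context: Let $X$ be $\mathbb{R}$ or $\mathbb{R}_+=(0,\infty)$. A weight on $X$ is a positive function integrable on every bounded interval $I\subset X$. Below $I$ denotes an arbitrary bounded interval contained in $X$, $|I|$ is its length, and $\sup_I,\inf_I$ mean essential supremum and infimum over $I$. For $1<r<\infty$, $w\in RH_r$ iff there is $C<\infty$ with $\left(\frac{1}{|I|}\int_I w^r\right)^{1/r}\le C\,\frac{1}{|I|}\int_I w$ for all $I$. $w\in A_1$ iff there is $c<\infty$ with $\frac{1}{|I|}\int_I w\le c\inf_I w$ for all $I$; $A_1(w)$ denotes the infimum of all such constants $c$. $w\in RH_\infty$ iff there is $c<\infty$ with $\sup_I w\le c\,\frac{1}{|I|}\int_I w$ for all $I$. *)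

theory Defs
  imports "HOL-Probability.Essential_Supremum"
begin

text \<open>The ground set \<open>X\<close> is a parameter throughout: \<open>UNIV\<close> for the real line, \<open>{0<..}\<close> for the
  half-line. Functions are total on the reals; their values outside \<open>X\<close> are irrelevant.\<close>

text \<open>Intervals may be open, closed or half-open. Null intervals are excluded, since averages are
  taken over them. For \<open>X = {0<..}\<close> the intervals \<open>{0<..<b}\<close> and \<open>{0<..b}\<close> are included.\<close>

definition bounded_intervals :: "real set \<Rightarrow> real set set" where
  "bounded_intervals X =
     {I. is_interval I \<and> bounded I \<and> I \<subseteq> X \<and> 0 < measure lebesgue I}"

definition weight_on :: "real set \<Rightarrow> (real \<Rightarrow> real) \<Rightarrow> bool" where
  "weight_on X w \<longleftrightarrow>
     (\<forall>x\<in>X. 0 < w x) \<and> (\<forall>I\<in>bounded_intervals X. set_integrable lebesgue I w)"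

definition average :: "real set \<Rightarrow> (real \<Rightarrow> real) \<Rightarrow> real" where
  "average I f = (LINT x:I|lebesgue. f x) / measure lebesgue I"

definition ess_sup_on :: "real set \<Rightarrow> (real \<Rightarrow> real) \<Rightarrow> ereal" where
  "ess_sup_on I f = esssup (lebesgue_on I) (\<lambda>x. ereal (f x))"

definition ess_inf_on :: "real set \<Rightarrow> (real \<Rightarrow> real) \<Rightarrow> ereal" where
  "ess_inf_on I f = - esssup (lebesgue_on I) (\<lambda>x. - ereal (f x))"

text \<open>The Bochner integral of a non-integrable function is 0, so finiteness of the left-hand side
  of the reverse Hoelder inequality has to be required explicitly.\<close>

definition RH :: "real set \<Rightarrow> real \<Rightarrow> (real \<Rightarrow> real) set" where
  "RH X r = {w. weight_on X w \<and>
     (\<exists>C::real. \<forall>I\<in>bounded_intervals X.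
        set_integrable lebesgue I (\<lambda>x. w x powr r) \<and>
        average I (\<lambda>x. w x powr r) powr (1 / r) \<le> C * average I w)}"

definition RH_infinity :: "real set \<Rightarrow> (real \<Rightarrow> real) set" where
  "RH_infinity X = {w. weight_on X w \<and>
     (\<exists>c::real. \<forall>I\<in>bounded_intervals X. ess_sup_on I w \<le> ereal (c * average I w))}"

definition A1_bound :: "real set \<Rightarrow> (real \<Rightarrow> real) \<Rightarrow> real \<Rightarrow> bool" where
  "A1_bound X w c \<longleftrightarrow>
     (\<forall>I\<in>bounded_intervals X. ereal (average I w) \<le> ereal c * ess_inf_on I w)"

definition A1 :: "real set \<Rightarrow> (real \<Rightarrow> real) set" where
  "A1 X = {w. weight_on X w \<and> (\<exists>c. A1_bound X w c)}"

definition A1_const :: "real set \<Rightarrow> (real \<Rightarrow> real) \<Rightarrow> real" where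
  "A1_const X w = Inf {c. A1_bound X w c}"

end

theory Submission
  imports Defs
begin

text \<open>
  That \<open>w\<close> lies in \<open>RH\<^sub>p\<close> below the critical exponent rests on a sharp self-improvement of
  \<open>A\<^sub>1\<close> weights on an interval: if every
  subinterval has average at most \<open>c\<close> times its infimum, then \<open>v\<close> satisfies a reverse Hoelder
  inequality with every exponent \<open>s < c / (c - 1)\<close> (\<open>A1_reverse_Hoelder\<close>). Given this, let \<open>p = r s\<close>.
  On an interval, \<open>w\<^sup>p = u\<^sup>p v\<^sup>s\<close> averages to at most a constant times \<open>(sup u)\<^sup>p (inf v)\<^sup>s\<close>, while
  the average of \<open>w\<close> is at least \<open>(inf v)\<close> to the power \<open>1 / r\<close> times the average of \<open>u\<close>, which is comparable to
  \<open>sup u\<close> (\<open>RH_mult_RH_infinity_A1\<close>). The condition \<open>s < c / (c - 1)\<close> is \<open>p < c r / (c - 1)\<close>.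

  The self-improvement has two ingredients. The first, \<open>superlevel_integral_le\<close>, is where the
  geometry of the line enters: for \<open>\<tau>\<close> at least the average of \<open>v\<close>, the integral of \<open>v\<close> over
  \<open>{v > \<tau>}\<close> is at most \<open>c \<tau>\<close> times the measure of that set. The superlevel set can be covered, up to
  arbitrarily small excess, by disjoint intervals on which \<open>v\<close> has infimum at most \<open>\<tau>\<close>, or which are limits
  of such intervals, unless one interval covers everything; in each case the average over the
  intervals is at most \<open>c \<tau>\<close>. The second, \<open>integral_powr_le_of_superlevel\<close>, is a computation on an arbitrary finite measure space:
  integrating the superlevel estimate against \<open>\<tau> powr (s - 2)\<close> bounds the integral of \<open>v\<^sup>s\<close> by a
  multiple of itself plus a controlled term, and the multiple can be absorbed precisely when
  \<open>c (s - 1) < s\<close>.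

  For the optimality, take \<open>u = 1\<close> and \<open>v\<close> the decreasing power with \<open>A\<^sub>1\<close> constant \<open>c\<close>, namely
  \<open>x powr (1 / c - 1)\<close>. At the critical \<open>p\<close> the function \<open>w\<^sup>p\<close> is \<open>1/x\<close>, which is not integrable at
  the origin (\<open>power_weight_extremal\<close>).
\<close>

section \<open>Superlevel sets on the line\<close>

text \<open>Connectedness of \<open>\<Omega>\<close> forces the open set \<open>J\<close> to have a boundary point in \<open>\<Omega>\<close>; as components
  are relatively closed, that point cannot belong to \<open>U\<close>.\<close>

lemma component_boundary_point:
  fixes J U \<Omega> :: "'a::euclidean_space set"
  assumes "open \<Omega>" "connected \<Omega>" "open U" "U \<subseteq> \<Omega>" "J \<in> components U" "J \<noteq> \<Omega>"
  obtains z where "z \<in> \<Omega>" "z \<notin> U" "z \<in> closure J"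
proof -
  have J: "J \<subseteq> U" "J \<noteq> {}" "open J"
    using assms open_components[of U J] in_components_subset[of J U] in_components_nonempty[of J U] by auto
  have "\<Omega> \<inter> frontier J \<noteq> {}"
    using connected_Int_frontier[OF \<open>connected \<Omega>\<close>, of J] J assms by auto
  then obtain z where z: "z \<in> \<Omega>" "z \<in> closure J" "z \<notin> J"
    using J by (auto simp: frontier_def interior_open)
  have "z \<notin> U"
  proof
    assume "z \<in> U"
    have "closedin (top_of_set U) J" using closedin_component[OF \<open>J \<in> components U\<close>] .
    then obtain T where T: "closed T" "J = U \<inter> T"
      by (auto simp: closedin_closed)
    then have "closure J \<subseteq> T"
      by (simp add: closure_minimal)
    with \<open>z \<in> U\<close> z T show False by auto
  qed
  with z that show ?thesis by blast
qed

text \<open>The hypothesis \<open>small\<close> is what an \<open>A\<^sub>1\<close> bound gives: an interval not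
  almost contained in \<open>{g > \<tau>}\<close> has average at most \<open>k\<close>. The task is to cover \<open>E\<close>, with little
  excess, by disjoint intervals of this kind. The components of a near-optimal open superset of \<open>E\<close>
  are disjoint, but some may lie almost entirely in \<open>{g > \<tau>}\<close>. Adjoining the union \<open>G\<close> of
  all open sets almost contained in \<open>{g > \<tau>}\<close>, which costs only a null set, makes any such
  component maximal. If it is all of \<open>\<Omega>\<close>, the hypothesis \<open>whole\<close> applies. Otherwise slightly larger
  intervals contain a point outside the cover, hence are not contained in \<open>G\<close>, hence obey
  \<open>small\<close>, and the bound passes to the limit. Disjointness of the cover is why no factor is lost
  over \<open>k\<close>.\<close>

lemma superlevel_integral_le:
  fixes g :: "real \<Rightarrow> real" and \<Omega> :: "real set"
  assumes \<Omega>: "open \<Omega>" "connected \<Omega>"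
    and g[measurable]: "g \<in> borel_measurable lebesgue"
    and k: "0 \<le> k"
    and small: "\<And>J. open J \<Longrightarrow> connected J \<Longrightarrow> J \<noteq> {} \<Longrightarrow> J \<subseteq> \<Omega> \<Longrightarrow>
        \<not> (AE x in lebesgue. x \<in> J \<longrightarrow> \<tau> < g x) \<Longrightarrow>
        (\<integral>\<^sup>+x\<in>J. ennreal (g x) \<partial>lebesgue) \<le> ennreal k * emeasure lebesgue J"
    and whole: "(\<integral>\<^sup>+x\<in>\<Omega>. ennreal (g x) \<partial>lebesgue) \<le> ennreal k * emeasure lebesgue \<Omega>"
  defines "E \<equiv> {x\<in>\<Omega>. \<tau> < g x}"
  shows "(\<integral>\<^sup>+x\<in>E. ennreal (g x) \<partial>lebesgue) \<le> ennreal k * emeasure lebesgue E"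
proof -
  define \<nu> where "\<nu> = density lebesgue (\<lambda>x. ennreal (g x))"
  have \<nu>: "emeasure \<nu> A = (\<integral>\<^sup>+x\<in>A. ennreal (g x) \<partial>lebesgue)" if "A \<in> sets lebesgue" for A
    unfolding \<nu>_def using that by (subst emeasure_density) auto
  have sets_\<nu>: "sets \<nu> = sets lebesgue" by (simp add: \<nu>_def)
  have op: "A \<in> sets lebesgue" if "open A" for A :: "real set"
    using that by (simp add: borel_open)
  have [measurable]: "\<Omega> \<in> sets lebesgue" using op \<Omega> by blast
  have "{x\<in>space lebesgue. \<tau> < g x} \<in> sets lebesgue"
    by measurable
  then have "\<Omega> \<inter> {x\<in>space lebesgue. \<tau> < g x} \<in> sets lebesgue" by measurable
  then have E[measurable]: "E \<in> sets lebesgue" 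
    by (simp add: E_def Int_def)
  define F where "F = {U. open U \<and> U \<subseteq> \<Omega> \<and> (AE x in lebesgue. x \<in> U \<longrightarrow> \<tau> < g x)}"
  define G where "G = \<Union>F"
  have "open G" "G \<subseteq> \<Omega>" by (auto simp: G_def F_def)
  obtain F' where F': "F' \<subseteq> F" "countable F'" "\<Union>F' = G"
    using Lindelof[of F] by (auto simp: G_def F_def)
  have "AE x in lebesgue. \<forall>U\<in>F'. x \<in> U \<longrightarrow> \<tau> < g x"
    using F' by (subst AE_ball_countable) (auto simp: F_def)
  then have G_AE: "AE x in lebesgue. x \<in> G \<longrightarrow> x \<in> E"
    using F' \<open>G \<subseteq> \<Omega>\<close> by (auto simp: E_def elim!: eventually_mono)
  have G_max: "J \<subseteq> G" if "open J" "J \<subseteq> \<Omega>" "AE x in lebesgue. x \<in> J \<longrightarrow> \<tau> < g x" for J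
    using that by (auto simp: G_def F_def)
  \<comment> \<open>Once a cover contains \<open>G\<close>, the bound holds on each of its components.\<close>
  have main: "emeasure \<nu> J \<le> ennreal k * emeasure lebesgue J"
    if U: "open U" "G \<subseteq> U" "U \<subseteq> \<Omega>" and J: "J \<in> components U" for U J
  proof (cases "(AE x in lebesgue. x \<in> J \<longrightarrow> \<tau> < g x) \<and> J \<noteq> \<Omega>")
    case False
    have "open J" "connected J" "J \<noteq> {}" "J \<subseteq> \<Omega>"
      using open_components[OF U(1) J] in_components_connected[OF J] in_components_nonempty[OF J]
        in_components_subset[OF J] U by auto
    with False show ?thesis using small whole by (auto simp: \<nu> op)
  next
    case True
    have Jp: "open J" "connected J" "J \<noteq> {}" "J \<subseteq> \<Omega>"
      using open_components[OF U(1) J] in_components_connected[OF J] in_components_nonempty[OF J]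
        in_components_subset[OF J] U by auto
    obtain z where z: "z \<in> \<Omega>" "z \<notin> U" "z \<in> closure J"
      using component_boundary_point[OF \<Omega> U(1,3) J] True by blast
    obtain d where d: "d > 0" "ball z d \<subseteq> \<Omega>"
      using z \<Omega> openE by blast
    show ?thesis
    proof (rule ennreal_le_epsilon)
      fix e :: real assume "0 < e"
      \<comment> \<open>Adding a ball of radius \<open>t\<close> lengthens \<open>J\<close> by at most \<open>2 t\<close>, hence raises the bound by at most \<open>e\<close>.\<close>
      define t where "t = min d (e / (2 * (k + 1)))"
      have t: "0 < t" "t \<le> d" "k * (2 * t) \<le> e"
      proof -
        show "0 < t" "t \<le> d" using d \<open>0 < e\<close> k by (auto simp: t_def)
        have "t \<le> e / (2 * (k + 1))" by (simp add: t_def)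
        then have "t * (2 * (k + 1)) \<le> e" using k by (subst (asm) pos_le_divide_eq) auto
        then show "k * (2 * t) \<le> e" using \<open>0 < t\<close> by (simp add: algebra_simps)
      qed
      define J' where "J' = J \<union> ball z t"
      have "ball z t \<inter> J \<noteq> {}"
        using z(3) t(1) by (metis closure_approachable dist_commute disjoint_iff mem_ball)
      then have "connected J'"
        unfolding J'_def using Jp by (intro connected_Un) auto
      have J'\<Omega>: "open J'" "J' \<subseteq> \<Omega>" "J' \<noteq> {}"
        using Jp d subset_ball[OF t(2), of z] by (auto simp: J'_def)
      have "\<not> (AE x in lebesgue. x \<in> J' \<longrightarrow> \<tau> < g x)"
      proof
        assume "AE x in lebesgue. x \<in> J' \<longrightarrow> \<tau> < g x"
        then have "J' \<subseteq> G" using G_max J'\<Omega> by blast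
        moreover have "z \<in> J'" using t by (simp add: J'_def)
        ultimately show False using z U by blast
      qed
      then have "emeasure \<nu> J' \<le> ennreal k * emeasure lebesgue J'"
        using small \<open>connected J'\<close> J'\<Omega> by (auto simp: \<nu> op)
      also have "\<dots> \<le> ennreal k * (emeasure lebesgue J + emeasure lebesgue (ball z t))"
        unfolding J'_def using Jp by (intro mult_left_mono emeasure_subadditive) (auto simp: op)
      also have "emeasure lebesgue (ball z t) = ennreal (2 * t)"
        using t by (simp add: ball_eq_greaterThanLessThan)
      also have "ennreal k * (emeasure lebesgue J + ennreal (2 * t)) =
          ennreal k * emeasure lebesgue J + ennreal (k * (2 * t))"
        using k t by (simp add: distrib_left ennreal_mult)
      also have "\<dots> \<le> ennreal k * emeasure lebesgue J + ennreal e"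
        using t by (intro add_left_mono ennreal_leI)
      finally have "emeasure \<nu> J' \<le> ennreal k * emeasure lebesgue J + ennreal e" .
      moreover have "emeasure \<nu> J \<le> emeasure \<nu> J'"
        by (intro emeasure_mono) (auto simp: J'_def sets_\<nu> op Jp)
      ultimately show "emeasure \<nu> J \<le> ennreal k * emeasure lebesgue J + ennreal e" by simp
    qed
  qed
  have "emeasure \<nu> E \<le> ennreal k * emeasure lebesgue E"
  proof (rule ennreal_le_epsilon)
    fix e :: real assume "0 < e"
    have pos: "0 < e / (k + 1)" using \<open>0 < e\<close> k by simp
    obtain T where T: "open T" "E \<subseteq> T" "T - E \<in> lmeasurable"
        "emeasure lebesgue (T - E) < ennreal (e / (k + 1))"
      by (rule sets_lebesgue_outer_open[OF E pos])
    define U where "U = (T \<inter> \<Omega>) \<union> G"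
    have U: "open U" "G \<subseteq> U" "U \<subseteq> \<Omega>" "E \<subseteq> U"
      using T \<Omega> \<open>open G\<close> \<open>G \<subseteq> \<Omega>\<close> by (auto simp: U_def E_def)
    have dis: "J \<inter> J' = {}" if "J \<in> components U" "J' \<in> components U" "J \<noteq> J'" for J J'
      using components_nonoverlap[OF that(1,2)] that(3) by simp
    have cU: "countable (components U)"
      using open_components[OF U(1)] dis
      by (intro countable_disjoint_open_subsets) (simp_all add: pairwise_def disjnt_def)
    have dis: "disjoint_family_on (\<lambda>J. J) (components U)"
      using dis by (simp add: disjoint_family_on_def)
    have cop: "J \<in> sets lebesgue" if "J \<in> components U" for J
      using that U open_components op by blast
    have "emeasure \<nu> U = (\<integral>\<^sup>+J. emeasure \<nu> J \<partial>count_space (components U))"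
      using emeasure_UN_countable[of "components U" "\<lambda>J. J" \<nu>] cU dis cop sets_\<nu>
      by (simp add: Union_components)
    also have "\<dots> \<le> (\<integral>\<^sup>+J. ennreal k * emeasure lebesgue J \<partial>count_space (components U))"
      using main[OF U(1-3)] by (intro nn_integral_mono) auto
    also have "\<dots> = ennreal k * (\<integral>\<^sup>+J. emeasure lebesgue J \<partial>count_space (components U))"
      by (intro nn_integral_cmult) auto
    also have "(\<integral>\<^sup>+J. emeasure lebesgue J \<partial>count_space (components U)) = emeasure lebesgue U"
      using emeasure_UN_countable[of "components U" "\<lambda>J. J" lebesgue] cU dis cop
      by (simp add: Union_components)
    finally have 1: "emeasure \<nu> U \<le> ennreal k * emeasure lebesgue U" .
    have "emeasure lebesgue U \<le> emeasure lebesgue T"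
      using G_AE T U by (intro emeasure_mono_AE) (auto simp: op U_def)
    also have "\<dots> \<le> emeasure lebesgue (E \<union> (T - E))"
      using T by (intro emeasure_mono) (auto simp: op)
    also have "\<dots> \<le> emeasure lebesgue E + emeasure lebesgue (T - E)"
      using T by (intro emeasure_subadditive) (auto simp: op)
    also have "\<dots> \<le> emeasure lebesgue E + ennreal (e / (k + 1))"
      using T by (intro add_left_mono) auto
    finally have "emeasure \<nu> U \<le> ennreal k * (emeasure lebesgue E + ennreal (e / (k + 1)))"
      by (intro order_trans[OF 1] mult_left_mono) auto
    also have "\<dots> = ennreal k * emeasure lebesgue E + ennreal (k * (e / (k + 1)))"
      using k \<open>0 < e\<close>
      by (simp add: distrib_left ennreal_mult del: times_divide_eq_right)
    also have "\<dots> \<le> ennreal k * emeasure lebesgue E + ennreal e"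
      using k \<open>0 < e\<close> by (intro add_left_mono ennreal_leI) (simp add: field_simps)
    finally have "emeasure \<nu> U \<le> ennreal k * emeasure lebesgue E + ennreal e" .
    moreover have "emeasure \<nu> E \<le> emeasure \<nu> U"
      using U by (intro emeasure_mono) (auto simp: sets_\<nu> op)
    ultimately show "emeasure \<nu> E \<le> ennreal k * emeasure lebesgue E + ennreal e" by simp
  qed
  then show ?thesis by (simp add: \<nu> E)
qed

section \<open>From superlevel sets to higher integrability\<close>

lemma nn_integral_powr_Ico:
  fixes m t \<beta> :: real
  assumes "0 < m" "m \<le> t" "\<beta> \<noteq> -1"
  shows "(\<integral>\<^sup>+x. ennreal (x powr \<beta>) * indicator {m..<t} x \<partial>lborel) =
         ennreal ((t powr (\<beta> + 1) - m powr (\<beta> + 1)) / (\<beta> + 1))"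
proof -
  have "(\<integral>\<^sup>+x. ennreal (x powr \<beta>) * indicator {m..<t} x \<partial>lborel) =
        (\<integral>\<^sup>+x. ennreal (x powr \<beta>) * indicator {m..t} x \<partial>lborel)"
    using AE_lborel_singleton[of t]
    by (intro nn_integral_cong_AE) (auto split: split_indicator elim!: eventually_mono)
  also have "\<dots> = ennreal (t powr (\<beta> + 1) / (\<beta> + 1) - m powr (\<beta> + 1) / (\<beta> + 1))"
  proof (rule nn_integral_FTC_Icc)
    show "((\<lambda>x. x powr (\<beta> + 1) / (\<beta> + 1)) has_real_derivative x powr \<beta>) (at x)"
      if "x \<in> {m..t}" for x
      using DERIV_cdivide[OF has_real_derivative_powr[of x "\<beta> + 1"], of "\<beta> + 1"] assms that by simp
  qed (use assms in auto)
  finally show ?thesis by (simp add: diff_divide_distrib)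
qed

text \<open>Write \<open>A = {f > m}\<close> and \<open>Q\<close> for the integral of \<open>f\<^sup>q\<close> over \<open>A\<close>. Multiplying the
  hypothesis \<open>level\<close> by \<open>\<tau> powr (q - 2)\<close> and integrating over \<open>\<tau> \<ge> m\<close> gives, by Tonelli,
  a bound of \<open>Q / (q - 1)\<close> by \<open>c Q / q\<close> plus lower-order terms. Since \<open>c (q - 1) < q\<close>, the term in
  \<open>Q\<close> can be absorbed on the left. Boundedness of \<open>f\<close> makes \<open>Q\<close> finite, as the absorption
  requires.\<close>

lemma integral_powr_le_of_superlevel_bounded:
  fixes f :: "'a \<Rightarrow> real" and m c q :: real
  assumes "finite_measure M" and f[measurable]: "f \<in> borel_measurable M"
    and bounded: "\<And>x. x \<in> space M \<Longrightarrow> 0 \<le> f x \<and> f x \<le> N"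
    and m: "0 < m" and q: "1 < q" and c: "0 < c" "c * (q - 1) < q"
    and level: "\<And>\<tau>. m \<le> \<tau> \<Longrightarrow> (\<integral>\<^sup>+x. ennreal (f x) * indicator {x. \<tau> < f x} x \<partial>M) \<le>
        ennreal (c * \<tau>) * emeasure M {x\<in>space M. \<tau> < f x}"
  shows "(\<integral>x. f x powr q \<partial>M) \<le> (1 + q * c / (q - c * (q - 1))) * m powr q * measure M (space M)"
proof -
  interpret finite_measure M by fact
  interpret pair_sigma_finite M lborel ..
  have bint: "integrable M h" if "h \<in> borel_measurable M" "\<And>x. x \<in> space M \<Longrightarrow> \<bar>h x\<bar> \<le> B" for h :: "'a \<Rightarrow> real" and B
    using that by (intro integrable_const_bound[of _ B]) auto
  define A where "A = {x\<in>space M. m < f x}"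
  have A[measurable]: "A \<in> sets M" by (simp add: A_def)
  have fin: "integrable M (\<lambda>x. f x powr \<beta> * indicator A x)" if "0 \<le> \<beta>" for \<beta>
    using bounded that
    by (intro bint[of _ "N powr \<beta>"]) (auto split: split_indicator intro!: powr_mono2)
  \<comment> \<open>The layer-cake formula, weighted by \<open>h\<close>; it is used with \<open>h = f\<close> and with \<open>h\<close> the constant \<open>c\<close>.\<close>
  have layer: "(\<integral>\<^sup>+\<tau>. (\<integral>\<^sup>+x. ennreal (h x) * ennreal (\<tau> powr \<beta>) * indicator {m..<f x} \<tau> \<partial>M) \<partial>lborel) =
      ennreal (\<integral>x. h x * ((f x powr (\<beta> + 1) - m powr (\<beta> + 1)) / (\<beta> + 1)) * indicator A x \<partial>M)"
    if h[measurable]: "h \<in> borel_measurable M" and h0: "\<And>x. x \<in> space M \<Longrightarrow> 0 \<le> h x" and \<beta>: "-1 < \<beta>"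
      and i: "integrable M (\<lambda>x. h x * ((f x powr (\<beta> + 1) - m powr (\<beta> + 1)) / (\<beta> + 1)) * indicator A x)"
    for h :: "'a \<Rightarrow> real" and \<beta>
  proof -
    \<comment> \<open>Rewriting the indicator as one on the product space makes joint measurability evident.\<close>
    have eq: "indicator {m..<f x} \<tau> = (indicator {y \<in> space (M \<Otimes>\<^sub>M lborel). m \<le> snd y \<and> snd y < f (fst y)} (x, \<tau>) :: ennreal)"
      if "x \<in> space M" for x \<tau>
      using that by (auto split: split_indicator simp: space_pair_measure)
    have [measurable]: "(\<lambda>(x, \<tau>). ennreal (h x) * ennreal (\<tau> powr \<beta>) * indicator {y \<in> space (M \<Otimes>\<^sub>M lborel). m \<le> snd y \<and> snd y < f (fst y)} (x, \<tau>)) \<in> borel_measurable (M \<Otimes>\<^sub>M lborel)"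
      by measurable
    have "(\<integral>\<^sup>+\<tau>. (\<integral>\<^sup>+x. ennreal (h x) * ennreal (\<tau> powr \<beta>) * indicator {m..<f x} \<tau> \<partial>M) \<partial>lborel) = 
       (\<integral>\<^sup>+\<tau>. (\<integral>\<^sup>+x. ennreal (h x) * ennreal (\<tau> powr \<beta>) * indicator {y \<in> space (M \<Otimes>\<^sub>M lborel). m \<le> snd y \<and> snd y < f (fst y)} (x, \<tau>) \<partial>M) \<partial>lborel)"
      by (intro nn_integral_cong) (simp add: eq)
    also have "\<dots> = (\<integral>\<^sup>+x. (\<integral>\<^sup>+\<tau>. ennreal (h x) * ennreal (\<tau> powr \<beta>) * indicator {y \<in> space (M \<Otimes>\<^sub>M lborel). m \<le> snd y \<and> snd y < f (fst y)} (x, \<tau>) \<partial>lborel) \<partial>M)"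
      by (rule Fubini') measurable
    also have "\<dots> = (\<integral>\<^sup>+x. (\<integral>\<^sup>+\<tau>. ennreal (h x) * (ennreal (\<tau> powr \<beta>) * indicator {m..<f x} \<tau>) \<partial>lborel) \<partial>M)"
      by (intro nn_integral_cong) (simp add: eq mult.assoc)
    also have "\<dots> = (\<integral>\<^sup>+x. ennreal (h x * ((f x powr (\<beta> + 1) - m powr (\<beta> + 1)) / (\<beta> + 1)) * indicator A x) \<partial>M)"
    proof (intro nn_integral_cong)
      fix x assume x: "x \<in> space M"
      have "(\<integral>\<^sup>+\<tau>. ennreal (h x) * (ennreal (\<tau> powr \<beta>) * indicator {m..<f x} \<tau>) \<partial>lborel) =
         ennreal (h x) * (\<integral>\<^sup>+\<tau>. ennreal (\<tau> powr \<beta>) * indicator {m..<f x} \<tau> \<partial>lborel)"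
        by (intro nn_integral_cmult) auto
      also have "\<dots> = ennreal (h x * ((f x powr (\<beta> + 1) - m powr (\<beta> + 1)) / (\<beta> + 1)) * indicator A x)"
      proof (cases "x \<in> A")
        case True
        then have "m \<le> f x" by (simp add: A_def)
        then show ?thesis using True h0[OF x] \<beta> m nn_integral_powr_Ico[of m "f x" \<beta>]
          by (simp add: powr_mono2 del: times_divide_eq_right flip: ennreal_mult)
      next
        case False
        then have "{m..<f x} = {}" using x by (auto simp: A_def)
        with False show ?thesis by simp
      qed
      finally show "(\<integral>\<^sup>+\<tau>. ennreal (h x) * (ennreal (\<tau> powr \<beta>) * indicator {m..<f x} \<tau>) \<partial>lborel) = \<dots>" .
    qed
    also have "\<dots> = ennreal (\<integral>x. h x * ((f x powr (\<beta> + 1) - m powr (\<beta> + 1)) / (\<beta> + 1)) * indicator A x \<partial>M)"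
    proof (rule nn_integral_eq_integral[OF i])
      have "0 \<le> h x * ((f x powr (\<beta> + 1) - m powr (\<beta> + 1)) / (\<beta> + 1)) * indicator A x" if "x \<in> space M" for x
        using that h0[OF that] \<beta> m by (auto simp: A_def powr_mono2 split: split_indicator)
      then show "AE x in M. 0 \<le> h x * ((f x powr (\<beta> + 1) - m powr (\<beta> + 1)) / (\<beta> + 1)) * indicator A x" by simp
    qed
    finally show ?thesis .
  qed
  define Q where "Q = (\<integral>x. f x powr q * indicator A x \<partial>M)"
  define P where "P = (\<integral>x. f x * indicator A x \<partial>M)"
  have f0: "0 \<le> f x" if "x \<in> space M" for x using bounded that by auto
  have iP: "integrable M (\<lambda>x. f x * indicator A x)"
    by (intro bint[of _ N]) (use bounded in \<open>force split: split_indicator\<close>)+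
  have iQ: "integrable M (\<lambda>x. f x powr q * indicator A x)" using fin q by auto
  have iA: "integrable M (\<lambda>x. indicator A x :: real)" by (intro bint[of _ 1]) auto
  have e1: "f x * ((f x powr (q - 2 + 1) - m powr (q - 2 + 1)) / (q - 2 + 1)) * indicator A x = 
      (f x powr q * indicator A x - m powr (q-1) * (f x * indicator A x)) / (q - 1)"
    if "x \<in> space M" for x
  proof -
    have "f x * f x powr (q - 1) = f x powr q" if "x \<in> A"
      using powr_mult_base[of "f x" "q - 1"] f0 that m by (simp add: A_def)
    then show ?thesis using q by (auto split: split_indicator simp: field_simps)
  qed
  have i1: "integrable M (\<lambda>x. (f x powr q * indicator A x - m powr (q-1) * (f x * indicator A x)) / (q - 1))"
    using iP iQ by auto
  have L: "(\<integral>\<^sup>+\<tau>. (\<integral>\<^sup>+x. ennreal (f x) * ennreal (\<tau> powr (q-2)) * indicator {m..<f x} \<tau> \<partial>M) \<partial>lborel)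
     = ennreal ((Q - m powr (q-1) * P) / (q-1))"
  proof -
    have "(\<integral>x. f x * ((f x powr (q - 2 + 1) - m powr (q - 2 + 1)) / (q - 2 + 1)) * indicator A x \<partial>M)
      = (\<integral>x. (f x powr q * indicator A x - m powr (q-1) * (f x * indicator A x)) / (q - 1) \<partial>M)"
      by (intro Bochner_Integration.integral_cong refl e1)
    also have "\<dots> = (Q - m powr (q-1) * P) / (q-1)"
      using iP iQ by (simp add: P_def Q_def)
    moreover have "integrable M (\<lambda>x. f x * ((f x powr (q - 2 + 1) - m powr (q - 2 + 1)) / (q - 2 + 1)) * indicator A x)"
      by (rule iffD2[OF Bochner_Integration.integrable_cong[OF refl e1] i1])
    ultimately show ?thesis
      using q by (subst layer) (auto simp: f0)
  qed
  have e2: "c * ((f x powr (q - 1 + 1) - m powr (q - 1 + 1)) / (q - 1 + 1)) * indicator A x = 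
      c * ((f x powr q * indicator A x - m powr q * indicator A x) / q)" for x
    by (auto split: split_indicator)
  have R: "(\<integral>\<^sup>+\<tau>. (\<integral>\<^sup>+x. ennreal c * ennreal (\<tau> powr (q-1)) * indicator {m..<f x} \<tau> \<partial>M) \<partial>lborel)
     = ennreal (c * ((Q - m powr q * measure M A) / q))"
  proof -
    have "(\<integral>x. c * ((f x powr (q - 1 + 1) - m powr (q - 1 + 1)) / (q - 1 + 1)) * indicator A x \<partial>M)
      = c * ((Q - m powr q * measure M A) / q)"
      unfolding e2 using iA iQ by (simp add: Q_def)
    moreover have "integrable M (\<lambda>x. c * ((f x powr (q - 1 + 1) - m powr (q - 1 + 1)) / (q - 1 + 1)) * indicator A x)"
      unfolding e2 using iA iQ by auto
    ultimately show ?thesis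
      using q c by (subst layer) auto
  qed
  have "ennreal ((Q - m powr (q-1) * P) / (q-1)) \<le> 
    (\<integral>\<^sup>+\<tau>. (\<integral>\<^sup>+x. ennreal c * ennreal (\<tau> powr (q-1)) * indicator {m..<f x} \<tau> \<partial>M) \<partial>lborel)"
    unfolding L[symmetric]
  proof (rule nn_integral_mono)
    fix \<tau> :: real
    show "(\<integral>\<^sup>+x. ennreal (f x) * ennreal (\<tau> powr (q-2)) * indicator {m..<f x} \<tau> \<partial>M) \<le>
      (\<integral>\<^sup>+x. ennreal c * ennreal (\<tau> powr (q-1)) * indicator {m..<f x} \<tau> \<partial>M)"
    proof (cases "m \<le> \<tau>")
      case True
      have ind: "indicator {m..<f x} \<tau> = (indicator {x. \<tau> < f x} x :: ennreal)" for x
        using True by (auto split: split_indicator)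
      have [simp]: "{x \<in> space M. \<tau> < f x} \<in> sets M" by measurable
      have "(\<integral>\<^sup>+x. indicator {x. \<tau> < f x} x \<partial>M) = (\<integral>\<^sup>+x. indicator {x\<in>space M. \<tau> < f x} x \<partial>M)"
        by (intro nn_integral_cong) (auto split: split_indicator)
      also have "\<dots> = emeasure M {x\<in>space M. \<tau> < f x}"
        by (rule nn_integral_indicator) measurable
      finally have S: "(\<integral>\<^sup>+x. indicator {x. \<tau> < f x} x \<partial>M) = emeasure M {x\<in>space M. \<tau> < f x}" .
      have "(\<integral>\<^sup>+x. ennreal (f x) * ennreal (\<tau> powr (q-2)) * indicator {m..<f x} \<tau> \<partial>M) =
         ennreal (\<tau> powr (q-2)) * (\<integral>\<^sup>+x. ennreal (f x) * indicator {x. \<tau> < f x} x \<partial>M)"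
        by (subst nn_integral_cmult[symmetric]) (auto simp: ind ac_simps)
      also have "\<dots> \<le> ennreal (\<tau> powr (q-2)) * (ennreal (c * \<tau>) * emeasure M {x\<in>space M. \<tau> < f x})"
        by (intro mult_left_mono level True) auto
      also have "\<dots> = ennreal (\<tau> powr (q-2) * (c * \<tau>)) * emeasure M {x\<in>space M. \<tau> < f x}"
        using c True m by (simp add: ennreal_mult mult.assoc)
      also have "\<tau> powr (q-2) * (c * \<tau>) = c * \<tau> powr (q-1)"
        using True m powr_mult_base[of \<tau> "q-2"] by (simp add: ac_simps)
      also have "ennreal (c * \<tau> powr (q-1)) * emeasure M {x\<in>space M. \<tau> < f x} = 
         (\<integral>\<^sup>+x. ennreal c * ennreal (\<tau> powr (q-1)) * indicator {m..<f x} \<tau> \<partial>M)"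
        using c by (simp add: ind nn_integral_cmult S ennreal_mult mult.assoc)
      finally show ?thesis .
    qed simp
  qed
  also have "\<dots> = ennreal (c * ((Q - m powr q * measure M A) / q))"
    by (rule R)
  finally have *: "ennreal ((Q - m powr (q-1) * P) / (q-1)) \<le> ennreal (c * ((Q - m powr q * measure M A) / q))" .
  have main: "(Q - m powr (q-1) * P) / (q-1) \<le> c * ((Q - m powr q * measure M A) / q)"
  proof -
    have "(\<integral>x. m powr q * indicator A x \<partial>M) \<le> Q"
      unfolding Q_def using iA iQ m q
      by (intro integral_mono) (auto simp: A_def powr_mono2 split: split_indicator)
    then have "0 \<le> c * ((Q - m powr q * measure M A) / q)"
      using c q by simp
    then show ?thesis using * by (simp add: ennreal_le_iff)
  qed
  have P: "P \<le> c * m * measure M A"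
  proof -
    have "ennreal P = (\<integral>\<^sup>+x. ennreal (f x * indicator A x) \<partial>M)"
      unfolding P_def by (rule nn_integral_eq_integral[symmetric, OF iP]) (auto simp: f0)
    also have "\<dots> = (\<integral>\<^sup>+x. ennreal (f x) * indicator {x. m < f x} x \<partial>M)"
      by (intro nn_integral_cong) (auto simp: A_def split: split_indicator)
    also have "\<dots> \<le> ennreal (c * m) * emeasure M A" using level[of m] by (simp add: A_def)
    also have "\<dots> = ennreal (c * m * measure M A)" 
      using c m by (simp add: emeasure_eq_measure ennreal_mult)
    finally show ?thesis using c m by (subst (asm) ennreal_le_iff) auto
  qed
  have "q * (Q - m powr (q-1) * P) \<le> c * (q - 1) * (Q - m powr q * measure M A)"
    using main q by (simp add: field_simps)
  then have "(q - c * (q - 1)) * Q \<le> q * m powr (q-1) * P - c * (q - 1) * (m powr q * measure M A)"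
    by (simp add: algebra_simps)
  also have "\<dots> \<le> q * m powr (q-1) * P"
    using c q by simp
  also have "\<dots> \<le> q * m powr (q-1) * (c * m * measure M A)"
    using P q by (intro mult_left_mono) auto
  also have "\<dots> = q * c * m powr q * measure M A"
    using powr_mult_base[of m "q-1"] m by (simp add: ac_simps)
  also have "\<dots> \<le> q * c * m powr q * measure M (space M)"
    using q c by (intro mult_left_mono finite_measure_mono) (auto simp: A_def)
  finally have "Q \<le> q * c / (q - c * (q - 1)) * m powr q * measure M (space M)"
    using c by (simp add: field_simps)
  moreover have "(\<integral>x. f x powr q \<partial>M) \<le> (\<integral>x. m powr q + f x powr q * indicator A x \<partial>M)"
  proof (rule integral_mono)
    show "integrable M (\<lambda>x. f x powr q)"
      using bounded q by (intro bint[of _ "N powr q"]) (auto intro!: powr_mono2)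
    show "integrable M (\<lambda>x. m powr q + f x powr q * indicator A x)"
      using iQ by simp
    show "f x powr q \<le> m powr q + f x powr q * indicator A x" if "x \<in> space M" for x
      using f0[OF that] that q by (auto simp: A_def split: split_indicator intro!: powr_mono2)
  qed
  moreover have "(\<integral>x. m powr q + f x powr q * indicator A x \<partial>M) = m powr q * measure M (space M) + Q"
    using iQ by (simp add: Q_def)
  ultimately show ?thesis by (simp add: algebra_simps)
qed

text \<open>The truncations \<open>min f n\<close> inherit the superlevel hypothesis: below level \<open>n\<close> they have the
  same superlevel sets as \<open>f\<close>, and above it none. The bound for them does not depend on \<open>n\<close>, so
  it survives monotone convergence.\<close>

lemma integral_powr_le_of_superlevel:
  fixes f :: "'a \<Rightarrow> real" and m c q :: real
  assumes M: "finite_measure M" and f[measurable]: "f \<in> borel_measurable M"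
    and f0: "\<And>x. x \<in> space M \<Longrightarrow> 0 \<le> f x"
    and m: "0 < m" and q: "1 < q" and c: "0 < c" "c * (q - 1) < q"
    and level: "\<And>\<tau>. m \<le> \<tau> \<Longrightarrow> (\<integral>\<^sup>+x. ennreal (f x) * indicator {x. \<tau> < f x} x \<partial>M) \<le>
        ennreal (c * \<tau>) * emeasure M {x\<in>space M. \<tau> < f x}"
  defines "K \<equiv> 1 + q * c / (q - c * (q - 1))"
  shows "integrable M (\<lambda>x. f x powr q)"
    and "(\<integral>x. f x powr q \<partial>M) \<le> K * m powr q * measure M (space M)"
proof -
  interpret finite_measure M by fact
  define B where "B = K * m powr q * measure M (space M)"
  define g where "g = (\<lambda>n x. min (f x) (real n))"
  have [measurable]: "g n \<in> borel_measurable M" for n by (simp add: g_def)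
  have g0: "0 \<le> g n x" if "x \<in> space M" for n x using f0[OF that] by (simp add: g_def)
  have gint: "integrable M (\<lambda>x. g n x powr q)" for n
    by (intro integrable_const_bound[of _ "real n powr q"])
       (use f0 q in \<open>auto simp: g_def intro!: powr_mono2\<close>)
  have gB: "(\<integral>x. g n x powr q \<partial>M) \<le> B" for n
    unfolding B_def K_def
  proof (rule integral_powr_le_of_superlevel_bounded[where N = "real n"])
    fix \<tau> assume \<tau>: "m \<le> \<tau>"
    show "(\<integral>\<^sup>+x. ennreal (g n x) * indicator {x. \<tau> < g n x} x \<partial>M) \<le>
        ennreal (c * \<tau>) * emeasure M {x\<in>space M. \<tau> < g n x}"
    proof (cases "\<tau> < real n")
      case True
      then have "{x\<in>space M. \<tau> < g n x} = {x\<in>space M. \<tau> < f x}" by (auto simp: g_def)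
      moreover have "(\<integral>\<^sup>+x. ennreal (g n x) * indicator {x. \<tau> < g n x} x \<partial>M) \<le>
          (\<integral>\<^sup>+x. ennreal (f x) * indicator {x. \<tau> < f x} x \<partial>M)"
        by (intro nn_integral_mono) (auto simp: g_def split: split_indicator intro!: ennreal_leI)
      ultimately show ?thesis using level[OF \<tau>] by simp
    qed (simp add: g_def)
  qed (use assms in \<open>auto simp: g_def\<close>)
  have lim: "(SUP n. ennreal (g n x powr q)) = ennreal (f x powr q)" if "x \<in> space M" for x
  proof (rule antisym)
    show "(SUP n. ennreal (g n x powr q)) \<le> ennreal (f x powr q)"
      using g0[OF that] q by (intro SUP_least ennreal_leI powr_mono2) (auto simp: g_def)
    obtain n where "f x \<le> real n" using real_arch_simple by blast
    then have "g n x = f x" by (simp add: g_def)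
    then show "ennreal (f x powr q) \<le> (SUP n. ennreal (g n x powr q))"
      by (intro SUP_upper2[of n]) auto
  qed
  have "(\<integral>\<^sup>+x. ennreal (f x powr q) \<partial>M) = (\<integral>\<^sup>+x. (SUP n. ennreal (g n x powr q)) \<partial>M)"
    by (intro nn_integral_cong) (simp add: lim)
  also have "\<dots> = (SUP n. \<integral>\<^sup>+x. ennreal (g n x powr q) \<partial>M)"
  proof (rule nn_integral_monotone_convergence_SUP_AE)
    show "AE x in M. ennreal (g i x powr q) \<le> ennreal (g (Suc i) x powr q)" for i
      using g0 q by (intro AE_I2 ennreal_leI powr_mono2) (auto simp: g_def)
  qed measurable
  also have "\<dots> \<le> ennreal B"
    using gB by (intro SUP_least) (simp add: nn_integral_eq_integral[OF gint] ennreal_leI)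
  finally have le: "(\<integral>\<^sup>+x. ennreal (f x powr q) \<partial>M) \<le> ennreal B" .
  then show int: "integrable M (\<lambda>x. f x powr q)"
    by (intro integrableI_bounded) (auto intro: le_less_trans)
  have "0 \<le> B" using c q by (simp add: B_def K_def)
  with le show "(\<integral>x. f x powr q \<partial>M) \<le> K * m powr q * measure M (space M)"
    by (simp add: nn_integral_eq_integral[OF int] flip: B_def)
qed

section \<open>Intervals, averages and weights\<close>

lemma bounded_intervals_bounds:
  assumes "I \<in> bounded_intervals X"
  obtains a b where "a < b" "{a<..<b} \<subseteq> I" "I \<subseteq> {a..b}"
proof -
  have I: "is_interval I" "bounded I" "0 < measure lebesgue I"
    using assms by (auto simp: bounded_intervals_def)
  have "I \<noteq> {}" using I(3) by auto
  have bd: "bdd_below I" "bdd_above I"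
    using I(2) by (auto intro: bounded_imp_bdd_below bounded_imp_bdd_above)
  have sub: "I \<subseteq> {Inf I..Sup I}"
    using bd by (auto intro: cInf_lower cSup_upper)
  have "Inf I < Sup I"
  proof (rule ccontr)
    assume "\<not> Inf I < Sup I"
    then have "I \<subseteq> {Inf I}" using sub by auto
    then have "negligible I" by (metis negligible_sing negligible_subset)
    then show False using I(3) by (simp add: negligible_imp_measure0)
  qed
  moreover have "{Inf I<..<Sup I} \<subseteq> I"
  proof
    fix x assume "x \<in> {Inf I<..<Sup I}"
    then have "Inf I < x" "x < Sup I" by auto
    then obtain y z where "y \<in> I" "y < x" "z \<in> I" "x < z"
      using cInf_lessD[OF \<open>I \<noteq> {}\<close>] less_cSupD[OF \<open>I \<noteq> {}\<close>] by blast
    then show "x \<in> I" using I(1) by (meson is_interval_1 less_imp_le)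
  qed
  ultimately show ?thesis using that sub by blast
qed

lemma bounded_interval_lmeasurable:
  "I \<in> bounded_intervals X \<Longrightarrow> I \<in> lmeasurable"
  by (auto simp: bounded_intervals_def is_interval_convex intro: measurable_convex)

lemma bounded_interval_sets:
  "I \<in> bounded_intervals X \<Longrightarrow> I \<in> sets lebesgue"
  using bounded_interval_lmeasurable by (rule fmeasurableD)

lemma open_connected_bounded_intervals:
  assumes "open J" "connected J" "J \<noteq> {}" "bounded J" "J \<subseteq> X"
  shows "J \<in> bounded_intervals X"
proof -
  have "J \<in> lmeasurable" using assms by (simp add: lmeasurable_open)
  moreover have "\<not> negligible J" using assms open_not_negligible by blast
  ultimately have "0 < measure lebesgue J"
    by (simp add: negligible_iff_measure zero_less_measure_iff)
  then show ?thesis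
    using assms by (simp add: bounded_intervals_def is_interval_connected_1)
qed

lemma AE_interior_bounded_interval:
  assumes "I \<in> bounded_intervals X"
  shows "AE x in lebesgue. x \<in> I \<longleftrightarrow> x \<in> interior I"
proof -
  have "negligible (frontier I)"
    using assms by (intro negligible_convex_frontier) (simp add: bounded_intervals_def is_interval_convex)
  then have "AE x in lebesgue. x \<notin> frontier I"
    by (simp add: negligible_iff_null_sets AE_not_in)
  then show ?thesis
    by (rule eventually_mono) (use closure_subset[of I] interior_subset[of I] in \<open>auto simp: frontier_def\<close>)
qed

lemma interior_bounded_intervals:
  assumes "I \<in> bounded_intervals X"
  shows "interior I \<in> bounded_intervals X"
proof (rule open_connected_bounded_intervals)
  have "convex I" using assms by (simp add: bounded_intervals_def is_interval_convex)
  then show "connected (interior I)" by (intro convex_connected convex_interior)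
  show "bounded (interior I)" "interior I \<subseteq> X"
    using assms interior_subset[of I] bounded_subset by (auto simp: bounded_intervals_def)
  obtain a b where ab: "a < b" "{a<..<b} \<subseteq> I" "I \<subseteq> {a..b}" using bounded_intervals_bounds[OF assms] .
  then have "{a<..<b} \<subseteq> interior I" by (intro interior_maximal) auto
  then show "interior I \<noteq> {}" using ab(1) by (metis dense greaterThanLessThan_iff subset_empty empty_iff)
qed auto

lemma average_mono:
  assumes "I \<in> bounded_intervals X" "set_integrable lebesgue I f" "set_integrable lebesgue I g"
    and "AE x in lebesgue. x \<in> I \<longrightarrow> f x \<le> g x"
  shows "average I f \<le> average I g"
  unfolding average_def using assms
  by (intro divide_right_mono set_integral_mono_AE) (auto simp: bounded_intervals_def)

lemma average_cmult: "average I (\<lambda>x. k * f x) = k * average I f"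
  by (simp add: average_def)

lemma set_integrable_const_bounded_interval:
  "I \<in> bounded_intervals X \<Longrightarrow> set_integrable lebesgue I (\<lambda>x. k :: real)"
  using bounded_interval_lmeasurable[of I X]
  by (auto simp: set_integrable_def fmeasurable_def intro!: integrable_mult_left integrable_real_indicator)

lemma average_const: "I \<in> bounded_intervals X \<Longrightarrow> average I (\<lambda>x. k) = k"
  using bounded_interval_lmeasurable[of I X]
  by (auto simp: average_def set_integral_const bounded_intervals_def fmeasurable_def)

lemma weight_measurable:
  assumes "weight_on X w" "I \<in> bounded_intervals X"
  shows "(\<lambda>x. indicator I x * w x) \<in> borel_measurable lebesgue"
  using assms by (auto simp: weight_on_def set_integrable_def dest!: bspec)

lemma weight_measurable_lebesgue_on:
  assumes "weight_on X w" "I \<in> bounded_intervals X"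
  shows "w \<in> borel_measurable (lebesgue_on I)"
proof -
  have "integrable (lebesgue_on I) w"
    using assms bounded_interval_sets[OF assms(2)]
    by (subst integrable_restrict_space) (auto simp: weight_on_def set_integrable_def)
  then show ?thesis by (rule borel_measurable_integrable)
qed

lemma weight_pos: "weight_on X w \<Longrightarrow> I \<in> bounded_intervals X \<Longrightarrow> x \<in> I \<Longrightarrow> 0 < w x"
  by (auto simp: weight_on_def bounded_intervals_def)

lemma weight_integrable: "weight_on X w \<Longrightarrow> I \<in> bounded_intervals X \<Longrightarrow> set_integrable lebesgue I w"
  by (auto simp: weight_on_def)

lemma set_borel_measurable_weight_powr:
  assumes "weight_on X w" "I \<in> bounded_intervals X"
  shows "set_borel_measurable lebesgue I (\<lambda>x. w x powr p)"
proof -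
  have "(\<lambda>x. (indicator I x * w x) powr p) \<in> borel_measurable lebesgue"
    using weight_measurable[OF assms] by measurable
  moreover have "(\<lambda>x. (indicator I x * w x) powr p) = (\<lambda>x. indicator I x *\<^sub>R (w x powr p))"
    by (auto split: split_indicator)
  ultimately show ?thesis by (simp add: set_borel_measurable_def)
qed

lemma average_weight_pos:
  assumes w: "weight_on X w" and I: "I \<in> bounded_intervals X"
  shows "0 < average I w"
proof -
  have int: "integrable lebesgue (\<lambda>x. indicator I x * w x)"
    using weight_integrable[OF w I] by (simp add: set_integrable_def)
  have nn: "0 \<le> indicator I x * w x" for x
    using weight_pos[OF w I, of x] by (auto split: split_indicator)
  have "(LINT x|lebesgue. indicator I x * w x) \<noteq> 0"
  proof
    assume "(LINT x|lebesgue. indicator I x * w x) = 0"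
    then have "AE x in lebesgue. indicator I x * w x = 0"
      using int nn by (simp add: integral_nonneg_eq_0_iff_AE)
    then have "AE x in lebesgue. x \<notin> I"
      by (rule eventually_mono) (use weight_pos[OF w I] in \<open>force split: split_indicator_asm\<close>)
    then have "I \<in> null_sets lebesgue" using bounded_interval_sets[OF I] by (simp add: AE_iff_null_sets)
    then show False using I by (simp add: bounded_intervals_def measure_eq_0_null_sets)
  qed
  moreover have "0 \<le> (LINT x|lebesgue. indicator I x * w x)" using nn by (intro Bochner_Integration.integral_nonneg) auto
  ultimately show ?thesis
    using I by (simp add: average_def set_lebesgue_integral_def bounded_intervals_def)
qed

lemma nn_integral_weight:
  assumes w: "weight_on X w" and I: "I \<in> bounded_intervals X"
  shows "(\<integral>\<^sup>+x\<in>I. ennreal (w x) \<partial>lebesgue) = ennreal (average I w) * emeasure lebesgue I"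
proof -
  have int: "integrable lebesgue (\<lambda>x. indicator I x * w x)"
    using weight_integrable[OF w I] by (simp add: set_integrable_def)
  have nn: "0 \<le> indicator I x * w x" for x
    using weight_pos[OF w I, of x] by (auto split: split_indicator)
  have "(\<integral>\<^sup>+x\<in>I. ennreal (w x) \<partial>lebesgue) = (\<integral>\<^sup>+x. ennreal (indicator I x * w x) \<partial>lebesgue)"
    by (intro nn_integral_cong) (auto split: split_indicator)
  also have "\<dots> = ennreal (LINT x|lebesgue. indicator I x * w x)"
    using int nn by (intro nn_integral_eq_integral) auto
  also have "(LINT x|lebesgue. indicator I x * w x) = average I w * measure lebesgue I"
    using I by (simp add: average_def set_lebesgue_integral_def bounded_intervals_def)
  also have "ennreal \<dots> = ennreal (average I w) * emeasure lebesgue I"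
    using bounded_interval_lmeasurable[OF I] average_weight_pos[OF w I]
    by (simp add: ennreal_mult emeasure_eq_measure2)
  finally show ?thesis .
qed

section \<open>The classes \<open>A\<^sub>1\<close>, \<open>RH\<^sub>\<infinity>\<close> and \<open>RH\<^sub>r\<close>\<close>

lemma A1_bound_pos:
  assumes w: "weight_on X w" and I: "I \<in> bounded_intervals X" and A: "A1_bound X w c"
  shows "0 < c"
proof (rule ccontr)
  assume "\<not> 0 < c"
  have "esssup (lebesgue_on I) (\<lambda>x. - ereal (w x)) \<le> 0"
  proof (rule esssup_I)
    have "w \<in> borel_measurable (lebesgue_on I)"
      by (rule weight_measurable_lebesgue_on[OF w I])
    then show "(\<lambda>x. - ereal (w x)) \<in> borel_measurable (lebesgue_on I)" by measurable
    show "AE x in lebesgue_on I. - ereal (w x) \<le> 0"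
      using weight_pos[OF w I] by (intro AE_I2) (auto intro: less_imp_le)
  qed
  then have "0 \<le> ess_inf_on I w" by (simp add: ess_inf_on_def)
  then have "ereal c * ess_inf_on I w \<le> 0"
    using \<open>\<not> 0 < c\<close> by (simp add: ereal_mult_le_0_iff)
  moreover have "ereal (average I w) \<le> ereal c * ess_inf_on I w"
    using A I by (simp add: A1_bound_def)
  ultimately have "ereal (average I w) \<le> 0" by (rule order_trans[rotated])
  then show False using average_weight_pos[OF w I] by simp
qed

text \<open>In this form, and its counterpart \<open>RH_infinity_AE\<close>, the conditions can be integrated: they
  compare a function pointwise with its average, without mentioning essential bounds.\<close>

lemma A1_bound_AE:
  assumes A: "A1_bound X w c" and "0 < c" and I: "I \<in> bounded_intervals X"
  shows "AE x in lebesgue. x \<in> I \<longrightarrow> average I w \<le> c * w x"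
proof -
  have "AE x in lebesgue_on I. - ereal (w x) \<le> - ess_inf_on I w"
    using esssup_AE[of "\<lambda>x. - ereal (w x)" "lebesgue_on I"] by (simp add: ess_inf_on_def)
  then have "AE x in lebesgue. x \<in> I \<longrightarrow> - ereal (w x) \<le> - ess_inf_on I w"
    using bounded_interval_sets[OF I] by (simp add: AE_restrict_space_iff)
  then show ?thesis
  proof (rule eventually_mono, intro impI)
    fix x assume "x \<in> I \<longrightarrow> - ereal (w x) \<le> - ess_inf_on I w" "x \<in> I"
    then have "- ereal (w x) \<le> - ess_inf_on I w" by blast
    then have "ess_inf_on I w \<le> ereal (w x)" by (simp only: ereal_minus_le_minus)
    then have "ereal c * ess_inf_on I w \<le> ereal c * ereal (w x)"
      using \<open>0 < c\<close> by (intro ereal_mult_left_mono) auto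
    moreover have "ereal (average I w) \<le> ereal c * ess_inf_on I w"
      using A I by (simp add: A1_bound_def)
    ultimately have "ereal (average I w) \<le> ereal c * ereal (w x)" by (rule order_trans[rotated])
    then show "average I w \<le> c * w x" by simp
  qed
qed

lemma A1_boundI:
  assumes w: "weight_on X w" and "0 < c"
    and le: "\<And>I x. I \<in> bounded_intervals X \<Longrightarrow> x \<in> I \<Longrightarrow> average I w \<le> c * w x"
  shows "A1_bound X w c"
  unfolding A1_bound_def
proof
  fix I assume I: "I \<in> bounded_intervals X"
  have "esssup (lebesgue_on I) (\<lambda>x. - ereal (w x)) \<le> ereal (- (average I w / c))"
  proof (rule esssup_I)
    have "w \<in> borel_measurable (lebesgue_on I)"
      by (rule weight_measurable_lebesgue_on[OF w I])
    then show "(\<lambda>x. - ereal (w x)) \<in> borel_measurable (lebesgue_on I)" by measurable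
    show "AE x in lebesgue_on I. - ereal (w x) \<le> ereal (- (average I w / c))"
      using le[OF I] \<open>0 < c\<close> by (intro AE_I2) (auto simp: field_simps)
  qed
  then have "ereal (average I w / c) \<le> ess_inf_on I w"
    unfolding ess_inf_on_def by (metis ereal_minus_le_minus ereal_uminus_uminus uminus_ereal.simps(1))
  then have "ereal c * ereal (average I w / c) \<le> ereal c * ess_inf_on I w"
    using \<open>0 < c\<close> by (intro ereal_mult_left_mono) auto
  then show "ereal (average I w) \<le> ereal c * ess_inf_on I w"
    using \<open>0 < c\<close> by simp
qed

lemma A1_bound_ge_1:
  assumes w: "weight_on X w" and I: "I \<in> bounded_intervals X" and A: "A1_bound X w c"
  shows "1 \<le> c"
proof -
  have "average I (\<lambda>x. average I w) \<le> average I (\<lambda>x. c * w x)"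
    using A1_bound_AE[OF A A1_bound_pos[OF w I A] I] weight_integrable[OF w I]
    by (intro average_mono[OF I] set_integrable_const_bounded_interval[OF I]) auto
  then have "average I w \<le> c * average I w" by (simp add: average_cmult average_const[OF I])
  then show ?thesis using average_weight_pos[OF w I] by simp
qed

lemma RH_infinity_AE:
  assumes "u \<in> RH_infinity X"
  obtains k where "0 \<le> k" "\<And>I. I \<in> bounded_intervals X \<Longrightarrow> AE x in lebesgue. x \<in> I \<longrightarrow> u x \<le> k * average I u"
proof -
  obtain c where u: "weight_on X u" and c: "\<And>I. I \<in> bounded_intervals X \<Longrightarrow> ess_sup_on I u \<le> ereal (c * average I u)"
    using assms by (auto simp: RH_infinity_def)
  have "AE x in lebesgue. x \<in> I \<longrightarrow> u x \<le> \<bar>c\<bar> * average I u" if I: "I \<in> bounded_intervals X" for I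
  proof -
    have "AE x in lebesgue_on I. ereal (u x) \<le> ess_sup_on I u"
      unfolding ess_sup_on_def by (rule esssup_AE)
    then have "AE x in lebesgue. x \<in> I \<longrightarrow> ereal (u x) \<le> ess_sup_on I u"
      using bounded_interval_sets[OF I] by (simp add: AE_restrict_space_iff)
    moreover have "c * average I u \<le> \<bar>c\<bar> * average I u"
      using average_weight_pos[OF u I] by (intro mult_right_mono) auto
    ultimately show ?thesis
      using c[OF I] by (elim eventually_mono) (metis ereal_less_eq(3) order_trans)
  qed
  then show ?thesis using that[of "\<bar>c\<bar>"] by auto
qed

text \<open>On an interval, replace \<open>u\<close> by its supremum in the average of \<open>w\<^sup>p\<close> and \<open>v\<close> by its infimum in
  the average of \<open>w\<close>; the hypotheses on \<open>u\<close> and \<open>v\<close> say that both replacements only cost constants.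
  A reverse Hoelder inequality for \<open>v\<close> with exponent \<open>s = p / r\<close> then transfers to \<open>w\<close>.\<close>

lemma RH_mult_RH_infinity_A1:
  assumes u: "u \<in> RH_infinity X" and v: "weight_on X v" and A: "A1_bound X v c"
    and w: "weight_on X w" and w_def: "w = (\<lambda>x. u x * v x powr (1 / r))"
    and r: "0 < r" and s: "0 < s" and K: "0 \<le> K"
    and rev: "\<And>I. I \<in> bounded_intervals X \<Longrightarrow> set_integrable lebesgue I (\<lambda>x. v x powr s) \<and>
        average I (\<lambda>x. v x powr s) \<le> K * average I v powr s"
  shows "w \<in> RH X (r * s)"
proof -
  define p where "p = r * s"
  have p: "0 < p" using r s by (simp add: p_def)
  have uw: "weight_on X u" using u by (simp add: RH_infinity_def)
  obtain k where k: "0 \<le> k" and kI: "\<And>I. I \<in> bounded_intervals X \<Longrightarrow> AE x in lebesgue. x \<in> I \<longrightarrow> u x \<le> k * average I u"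
    using RH_infinity_AE[OF u] by blast
  have "set_integrable lebesgue I (\<lambda>x. w x powr p) \<and>
        average I (\<lambda>x. w x powr p) powr (1 / p) \<le> k * K powr (1 / p) * c powr (1 / r) * average I w"
    if I: "I \<in> bounded_intervals X" for I
  proof -
    note c = A1_bound_pos[OF v I A]
    define B where "B = k * average I u"
    define m where "m = average I v"
    have m: "0 < m" using average_weight_pos[OF v I] by (simp add: m_def)
    have B: "0 \<le> B" using average_weight_pos[OF uw I] k by (simp add: B_def)
    have upper: "AE x in lebesgue. x \<in> I \<longrightarrow> w x powr p \<le> B powr p * v x powr s"
      using kI[OF I]
    proof (rule eventually_mono, intro impI)
      fix x assume "x \<in> I \<longrightarrow> u x \<le> k * average I u" and x: "x \<in> I"
      then have "u x \<le> B" by (simp add: B_def)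
      moreover have "w x powr p = u x powr p * v x powr s"
        using weight_pos[OF uw I x] weight_pos[OF v I x] r by (simp add: w_def powr_mult powr_powr p_def)
      ultimately show "w x powr p \<le> B powr p * v x powr s"
        using weight_pos[OF uw I x] p by (auto intro!: mult_right_mono powr_mono2)
    qed
    have int: "set_integrable lebesgue I (\<lambda>x. w x powr p)"
    proof (rule set_integrable_bound)
      show "set_integrable lebesgue I (\<lambda>x. B powr p * v x powr s)" using rev[OF I] by auto
      show "set_borel_measurable lebesgue I (\<lambda>x. w x powr p)"
        using set_borel_measurable_weight_powr[OF w I] .
      show "AE x in lebesgue. x \<in> I \<longrightarrow> norm (w x powr p) \<le> norm (B powr p * v x powr s)"
        using upper by (rule eventually_mono) auto
    qed
    have "average I (\<lambda>x. w x powr p) \<le> average I (\<lambda>x. B powr p * v x powr s)"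
      using int rev[OF I] upper by (intro average_mono[OF I]) auto
    also have "\<dots> \<le> B powr p * (K * m powr s)"
      using rev[OF I] by (simp add: average_cmult m_def mult_left_mono)
    finally have "average I (\<lambda>x. w x powr p) powr (1 / p) \<le> (B powr p * (K * m powr s)) powr (1 / p)"
      using p by (intro powr_mono2) (auto simp: average_def set_lebesgue_integral_def)
    also have "\<dots> = B * K powr (1 / p) * m powr (1 / r)"
      using B K p m r s by (simp add: powr_mult powr_powr p_def)
    also have "\<dots> = k * K powr (1 / p) * c powr (1 / r) * (average I u * (m / c) powr (1 / r))"
      using c m by (simp add: B_def powr_divide)
    \<comment> \<open>Here \<open>m / c\<close> stands in for the infimum of \<open>v\<close>, which the \<open>A\<^sub>1\<close> bound puts above it.\<close>
    also have "average I u * (m / c) powr (1 / r) \<le> average I w"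
    proof -
      have "average I (\<lambda>x. (m / c) powr (1 / r) * u x) \<le> average I w"
      proof (rule average_mono[OF I])
        show "set_integrable lebesgue I (\<lambda>x. (m / c) powr (1 / r) * u x)"
          using weight_integrable[OF uw I] by auto
        show "AE x in lebesgue. x \<in> I \<longrightarrow> (m / c) powr (1 / r) * u x \<le> w x"
          using A1_bound_AE[OF A c I]
        proof (rule eventually_mono, intro impI)
          fix x assume "x \<in> I \<longrightarrow> average I v \<le> c * v x" and x: "x \<in> I"
          then have "m / c \<le> v x" using c by (simp add: m_def field_simps)
          then have "(m / c) powr (1 / r) \<le> v x powr (1 / r)"
            using m c r by (intro powr_mono2) auto
          then show "(m / c) powr (1 / r) * u x \<le> w x"
            using weight_pos[OF uw I x] by (simp add: w_def mult.commute mult_left_mono)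
        qed
      qed (rule weight_integrable[OF w I])
      then show ?thesis by (metis average_cmult mult.commute)
    qed
    finally show ?thesis using int k by (simp add: mult_left_mono)
  qed
  then show ?thesis using w unfolding RH_def p_def[symmetric] by blast
qed

section \<open>Sharp reverse Hoelder inequality for \<open>A\<^sub>1\<close>\<close>

text \<open>For levels \<open>\<tau>\<close> at or above the average \<open>m\<close> of \<open>v\<close> the interval itself satisfies the bound by
  \<open>c \<tau>\<close> that the covering argument asks of it, because \<open>c \<ge> 1\<close>; lower levels enter only through
  \<open>m\<^sup>s\<close>. The work is done on the interior, where the covering argument applies, and carried back to
  the interval across its null boundary.\<close>

lemma A1_reverse_Hoelder:
  assumes v: "weight_on X v" and A: "A1_bound X v c"
    and s: "1 < s" "c * (s - 1) < s" and I: "I \<in> bounded_intervals X"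
  defines "K \<equiv> 1 + s * c / (s - c * (s - 1))"
  shows "set_integrable lebesgue I (\<lambda>x. v x powr s)"
    and "average I (\<lambda>x. v x powr s) \<le> K * average I v powr s"
proof -
  define m where "m = average I v"
  have m: "0 < m" using average_weight_pos[OF v I] by (simp add: m_def)
  have c: "1 \<le> c" using A1_bound_ge_1[OF v I A] .
  have [measurable]: "I \<in> sets lebesgue" using bounded_interval_sets[OF I] .
  define g where "g = (\<lambda>x. indicator I x * v x)"
  have g[measurable]: "g \<in> borel_measurable lebesgue"
    unfolding g_def by (rule weight_measurable[OF v I])
  define \<Omega> where "\<Omega> = interior I"
  have \<Omega>I: "\<Omega> \<in> bounded_intervals X" "open \<Omega>" "\<Omega> \<subseteq> I"
    using interior_bounded_intervals[OF I] interior_subset by (auto simp: \<Omega>_def)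
  have \<Omega>_AE: "AE x in lebesgue. x \<in> I \<longleftrightarrow> x \<in> \<Omega>"
    unfolding \<Omega>_def by (rule AE_interior_bounded_interval[OF I])
  have small: "(\<integral>\<^sup>+x\<in>J. ennreal (g x) \<partial>lebesgue) \<le> ennreal (c * \<tau>) * emeasure lebesgue J"
    if J: "J \<in> bounded_intervals X" "J \<subseteq> I" and \<tau>: "0 < \<tau>" and le: "average J v \<le> c * \<tau>" for J \<tau>
  proof -
    have "(\<integral>\<^sup>+x\<in>J. ennreal (g x) \<partial>lebesgue) = (\<integral>\<^sup>+x\<in>J. ennreal (v x) \<partial>lebesgue)"
      using J(2) by (intro nn_integral_cong) (auto simp: g_def split: split_indicator)
    also have "\<dots> = ennreal (average J v) * emeasure lebesgue J"
      by (rule nn_integral_weight[OF v J(1)])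
    also have "\<dots> \<le> ennreal (c * \<tau>) * emeasure lebesgue J"
      using le by (intro mult_right_mono ennreal_leI) auto
    finally show ?thesis .
  qed
  have "average \<Omega> v = average I v"
  proof -
    have "set_lebesgue_integral lebesgue I v = set_lebesgue_integral lebesgue \<Omega> v"
      unfolding set_lebesgue_integral_def
    proof (rule integral_cong_AE)
      show "(\<lambda>x. indicat_real I x *\<^sub>R v x) \<in> borel_measurable lebesgue"
        "(\<lambda>x. indicat_real \<Omega> x *\<^sub>R v x) \<in> borel_measurable lebesgue"
        using weight_measurable[OF v I] weight_measurable[OF v \<Omega>I(1)] by simp_all
      show "AE x in lebesgue. indicat_real I x *\<^sub>R v x = indicat_real \<Omega> x *\<^sub>R v x"
        using \<Omega>_AE by (rule eventually_mono) (auto split: split_indicator)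
    qed
    moreover have "emeasure lebesgue I = emeasure lebesgue \<Omega>"
      using \<Omega>_AE bounded_interval_sets[OF \<Omega>I(1)] by (intro emeasure_eq_AE) auto
    ultimately show ?thesis by (simp add: average_def measure_def)
  qed
  then have \<Omega>m: "average \<Omega> v = m" by (simp add: m_def)
  have level: "(\<integral>\<^sup>+x. ennreal (v x) * indicator {x. \<tau> < v x} x \<partial>lebesgue_on I) \<le>
        ennreal (c * \<tau>) * emeasure (lebesgue_on I) {x\<in>space (lebesgue_on I). \<tau> < v x}" if "m \<le> \<tau>" for \<tau>
  proof -
    define E where "E = {x\<in>\<Omega>. \<tau> < g x}"
    have \<tau>: "0 < \<tau>" using m that by simp
    have gv: "g x = v x" if "x \<in> I" for x using that by (simp add: g_def)
    have "(\<integral>\<^sup>+x. ennreal (v x) * indicator {x. \<tau> < v x} x \<partial>lebesgue_on I) =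
        (\<integral>\<^sup>+x. ennreal (v x) * indicator {x. \<tau> < v x} x * indicator I x \<partial>lebesgue)"
      by (intro nn_integral_restrict_space) simp
    also have "\<dots> = (\<integral>\<^sup>+x\<in>E. ennreal (g x) \<partial>lebesgue)"
      using \<Omega>_AE
      by (intro nn_integral_cong_AE, elim eventually_mono) (auto simp: E_def gv split: split_indicator)
    also have "\<dots> \<le> ennreal (c * \<tau>) * emeasure lebesgue E"
      unfolding E_def
    proof (rule superlevel_integral_le)
      show "connected \<Omega>" using \<Omega>I(1) by (simp add: bounded_intervals_def is_interval_connected_1)
      show "0 \<le> c * \<tau>" using c \<tau> by simp
      show "(\<integral>\<^sup>+x\<in>\<Omega>. ennreal (g x) \<partial>lebesgue) \<le> ennreal (c * \<tau>) * emeasure lebesgue \<Omega>"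
      proof (rule small[OF \<Omega>I(1,3) \<tau>])
        show "average \<Omega> v \<le> c * \<tau>"
          using \<Omega>m that mult_right_mono[OF c, of \<tau>] \<tau> by linarith
      qed
      fix J assume J: "open J" "connected J" "J \<noteq> {}" "J \<subseteq> \<Omega>"
        and nAE: "\<not> (AE x in lebesgue. x \<in> J \<longrightarrow> \<tau> < g x)"
      have JX: "J \<in> bounded_intervals X"
        using J \<Omega>I(1) bounded_subset[of \<Omega> J]
        by (intro open_connected_bounded_intervals) (auto simp: bounded_intervals_def)
      show "(\<integral>\<^sup>+x\<in>J. ennreal (g x) \<partial>lebesgue) \<le> ennreal (c * \<tau>) * emeasure lebesgue J"
      proof (rule small[OF JX _ \<tau>])
        show "average J v \<le> c * \<tau>"
        proof (rule ccontr)
          assume gt: "\<not> average J v \<le> c * \<tau>"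
          have "AE x in lebesgue. x \<in> J \<longrightarrow> \<tau> < g x"
            using A1_bound_AE[OF A less_le_trans[OF zero_less_one c] JX]
          proof (rule eventually_mono, intro impI)
            fix x assume "x \<in> J \<longrightarrow> average J v \<le> c * v x" and x: "x \<in> J"
            then have "c * \<tau> < c * v x" using gt by simp
            then have "\<tau> < v x" using c by simp
            then show "\<tau> < g x" using x J(4) \<Omega>I(3) gv by auto
          qed
          with nAE show False by blast
        qed
      qed (use J \<Omega>I in auto)
    qed (use \<Omega>I in auto)
    also have "emeasure lebesgue E = emeasure lebesgue {x\<in>I. \<tau> < v x}"
    proof (rule emeasure_eq_AE)
      have *: "{x \<in> S. \<tau> < g x} \<in> sets lebesgue" if "S \<in> sets lebesgue" for S
      proof -
        have "S \<inter> {x \<in> space lebesgue. \<tau> < g x} \<in> sets lebesgue" using that by measurable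
        then show ?thesis by (simp add: Int_def)
      qed
      show "E \<in> sets lebesgue" unfolding E_def using * bounded_interval_sets[OF \<Omega>I(1)] by blast
      have "{x\<in>I. \<tau> < v x} = {x\<in>I. \<tau> < g x}" using gv by auto
      then show "{x\<in>I. \<tau> < v x} \<in> sets lebesgue" using *[of I] by simp
      show "AE x in lebesgue. (x \<in> E) = (x \<in> {x\<in>I. \<tau> < v x})"
        using \<Omega>_AE by (rule eventually_mono) (auto simp: E_def gv)
    qed
    also have "\<dots> = emeasure (lebesgue_on I) {x\<in>space (lebesgue_on I). \<tau> < v x}"
      by (subst emeasure_restrict_space) auto
    finally show ?thesis .
  qed
  have fin: "finite_measure (lebesgue_on I)"
    using bounded_interval_lmeasurable[OF I] by (intro finite_measureI) (auto simp: emeasure_restrict_space fmeasurable_def)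
  note G = integral_powr_le_of_superlevel[OF fin weight_measurable_lebesgue_on[OF v I] _ m s(1) _ s(2) level]
  have i: "integrable (lebesgue_on I) (\<lambda>x. v x powr s)"
    using G(1) weight_pos[OF v I] c by (auto intro: less_imp_le)
  then show int: "set_integrable lebesgue I (\<lambda>x. v x powr s)"
    by (simp add: set_integrable_def integrable_restrict_space)
  have "(\<integral>x. v x powr s \<partial>lebesgue_on I) \<le> K * m powr s * measure (lebesgue_on I) (space (lebesgue_on I))"
    unfolding K_def using G(2) weight_pos[OF v I] c by (auto intro: less_imp_le)
  also have "measure (lebesgue_on I) (space (lebesgue_on I)) = measure lebesgue I"
    by (simp add: measure_restrict_space)
  also have "(\<integral>x. v x powr s \<partial>lebesgue_on I) = (LINT x:I|lebesgue. v x powr s)"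
    by (simp add: integral_restrict_space set_lebesgue_integral_def)
  finally show "average I (\<lambda>x. v x powr s) \<le> K * average I v powr s"
    unfolding m_def[symmetric] using I
    by (simp add: average_def bounded_intervals_def divide_le_eq)
qed

section \<open>Integrability of the product below the critical exponent\<close>

lemma unit_interval_bounded_interval: "{0<..<1} \<in> bounded_intervals {0<..}" "{0<..<1} \<in> bounded_intervals UNIV"
  by (rule open_connected_bounded_intervals; force)+

text \<open>As \<open>A1_const\<close> is an infimum, a strict inequality for it also holds for some genuine \<open>A\<^sub>1\<close>
  bound \<open>c\<close>. At the endpoint \<open>p = r\<close> the exponent for \<open>v\<close> is \<open>1\<close> and any bound will do.\<close>

lemma RH_of_A1_const:
  assumes r: "1 < r" and w: "weight_on X w" and w_def: "w = (\<lambda>x. u x * v x powr (1 / r))"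
    and u: "u \<in> RH_infinity X" and v: "v \<in> A1 X" and ne: "bounded_intervals X \<noteq> {}"
    and p: "r \<le> p" "A1_const X v = 1 \<or> p < A1_const X v * r / (A1_const X v - 1)"
  shows "w \<in> RH X p"
proof -
  obtain I where I: "I \<in> bounded_intervals X" using ne by blast
  have vw: "weight_on X v" and ex: "\<exists>c. A1_bound X v c" using v by (auto simp: A1_def)
  define c2 where "c2 = A1_const X v"
  have c2: "1 \<le> c2"
    unfolding c2_def A1_const_def using ex A1_bound_ge_1[OF vw I] by (intro cInf_greatest) auto
  define s where "s = p / r"
  have s: "1 \<le> s" "c2 * (s - 1) < s" "p = r * s"
  proof -
    show "1 \<le> s" "p = r * s" using p r by (auto simp: s_def)
    show "c2 * (s - 1) < s"
    proof (cases "c2 = 1")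
      case False
      then have "p < c2 * r / (c2 - 1)" "0 < c2 - 1" using p c2 by (auto simp: c2_def)
      then have "p * (c2 - 1) < c2 * r" by (simp add: field_simps)
      then have "r * (s * (c2 - 1)) < r * c2" by (simp add: \<open>p = r * s\<close> mult_ac)
      then have "s * (c2 - 1) < c2" using r by simp
      then show ?thesis by (simp add: algebra_simps)
    qed simp
  qed
  show ?thesis
  proof (cases "s = 1")
    case True
    obtain c where c: "A1_bound X v c" using ex by blast
    have "w \<in> RH X (r * 1)"
    proof (rule RH_mult_RH_infinity_A1[OF u vw c w w_def, where K = 1])
      fix I assume I: "I \<in> bounded_intervals X"
      have eq: "v x powr 1 = v x" if "x \<in> I" for x using weight_pos[OF vw I that] by simp
      have "set_integrable lebesgue I (\<lambda>x. v x powr 1)"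
        using weight_integrable[OF vw I] eq by (subst set_integrable_cong[OF refl refl eq]) auto
      moreover have "average I (\<lambda>x. v x powr 1) = average I v"
        unfolding average_def using bounded_interval_sets[OF I] eq
        by (subst set_lebesgue_integral_cong[where g = v]) auto
      ultimately show "set_integrable lebesgue I (\<lambda>x. v x powr 1) \<and>
          average I (\<lambda>x. v x powr 1) \<le> 1 * average I v powr 1"
        using average_weight_pos[OF vw I] by simp
    qed (use r in auto)
    then show ?thesis using True s by simp
  next
    case False
    then have s1: "1 < s" using s by simp
    have "c2 < s / (s - 1)" using s s1 by (simp add: field_simps)
    then obtain c where c: "A1_bound X v c" "c < s / (s - 1)"
      using cInf_lessD[of "{c. A1_bound X v c}"] ex by (auto simp: c2_def A1_const_def)
    then have cs: "c * (s - 1) < s" using s1 by (simp add: field_simps)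
    have "w \<in> RH X (r * s)"
    proof (rule RH_mult_RH_infinity_A1[OF u vw c(1) w w_def])
      show "0 \<le> 1 + s * c / (s - c * (s - 1))"
        using cs s1 A1_bound_pos[OF vw I c(1)] by simp
    qed (use A1_reverse_Hoelder[OF vw c(1) s1 cs] r s1 in auto)
    then show ?thesis using s by simp
  qed
qed

section \<open>Power weights and optimality\<close>

lemma RH_infinity_one: "(\<lambda>x. 1) \<in> RH_infinity X"
proof -
  have "ess_sup_on I (\<lambda>x. 1) \<le> ereal (1 * average I (\<lambda>x. 1))" if "I \<in> bounded_intervals X" for I
    unfolding ess_sup_on_def average_const[OF that] by (intro esssup_I) auto
  then show ?thesis
    by (auto simp: RH_infinity_def weight_on_def set_integrable_const_bounded_interval intro!: exI[of _ 1])
qed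

lemma weight_on_powr:
  assumes w: "weight_on X w" and e: "0 < e" "e \<le> 1"
  shows "weight_on X (\<lambda>x. w x powr e)"
  unfolding weight_on_def
proof (intro conjI ballI)
  show "0 < w x powr e" if "x \<in> X" for x using w that by (force simp: weight_on_def)
  fix I assume I: "I \<in> bounded_intervals X"
  show "set_integrable lebesgue I (\<lambda>x. w x powr e)"
  proof (rule set_integrable_bound)
    show "set_integrable lebesgue I (\<lambda>x. 1 + w x)"
      using set_integrable_const_bounded_interval[OF I] weight_integrable[OF w I] by (rule set_integral_add)
    have "w x powr e \<le> 1 + w x" if "x \<in> I" for x
    proof (cases "w x \<le> 1")
      case True
      then show ?thesis using weight_pos[OF w I that] e powr_le1[of e "w x"] by simp
    next
      case False
      then show ?thesis using powr_mono[of e 1 "w x"] e by simp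
    qed
    then show "AE x in lebesgue. x \<in> I \<longrightarrow> norm (w x powr e) \<le> norm (1 + w x)"
      using weight_pos[OF w I] by (intro AE_I2) force
  qed (rule set_borel_measurable_weight_powr[OF w I])
qed

text \<open>With exponent written as \<open>1 / c - 1\<close>, the average over \<open>(0, b)\<close> is exactly \<open>c\<close> times the value
  at \<open>b\<close>, which for \<open>c > 1\<close> is the infimum: this is the choice of power for which the \<open>A\<^sub>1\<close> constant is \<open>c\<close>.\<close>

lemma has_integral_powr_Icc:
  fixes a b c :: real
  assumes "0 < c" "0 \<le> a" "a \<le> b"
  shows "((\<lambda>x. x powr (1 / c - 1)) has_integral c * b powr (1 / c) - c * a powr (1 / c)) {a..b}"
proof (rule fundamental_theorem_of_calculus_interior)
  show "continuous_on {a..b} (\<lambda>x. c * x powr (1 / c))"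
    using assms by (intro continuous_intros continuous_on_powr') auto
  show "((\<lambda>x. c * x powr (1 / c)) has_vector_derivative x powr (1 / c - 1)) (at x)" if "x \<in> {a<..<b}" for x
    using DERIV_cmult[OF has_real_derivative_powr[of x "1 / c"], of c] that assms
    by (simp add: has_real_derivative_iff_has_vector_derivative)
qed fact

lemma set_integrable_powr_Icc:
  fixes a b c :: real
  assumes "0 < c" "0 \<le> a" "a \<le> b"
  shows "set_integrable lebesgue {a..b} (\<lambda>x. x powr (1 / c - 1))"
  using has_integral_powr_Icc[OF assms] by (intro nonnegative_absolutely_integrable_1) auto

lemma bounded_intervals_halfline_bounds:
  assumes "I \<in> bounded_intervals {0<..}"
  obtains a b where "0 \<le> a" "a < b" "{a<..<b} \<subseteq> I" "I \<subseteq> {a..b}" "measure lebesgue I = b - a"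
proof -
  obtain a b where ab: "a < b" "{a<..<b} \<subseteq> I" "I \<subseteq> {a..b}" using bounded_intervals_bounds[OF assms] .
  have I: "I \<in> lmeasurable" using bounded_interval_lmeasurable[OF assms] .
  have "0 \<le> a"
  proof (rule ccontr)
    assume "\<not> 0 \<le> a"
    then obtain x where "a < x" "x < b" "x < 0" using ab(1) dense[of a "min b 0"] by auto
    then show False using ab(2) assms by (force simp: bounded_intervals_def)
  qed
  moreover have "measure lebesgue I = b - a"
  proof (rule antisym)
    have "measure lebesgue I \<le> measure lebesgue {a..b}"
      using ab I by (intro measure_mono_fmeasurable) auto
    then show "measure lebesgue I \<le> b - a" using ab by simp
    have "measure lebesgue {a<..<b} \<le> measure lebesgue I"
      using ab I by (intro measure_mono_fmeasurable) auto
    then show "b - a \<le> measure lebesgue I" using ab by simp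
  qed
  ultimately show ?thesis using that ab by blast
qed

lemma weight_on_halfline_powr:
  assumes "0 < c"
  shows "weight_on {0<..} (\<lambda>x. x powr (1 / c - 1))"
  unfolding weight_on_def
proof (intro conjI ballI)
  fix I assume I: "I \<in> bounded_intervals {0<..}"
  obtain a b where "0 \<le> a" "a < b" "{a<..<b} \<subseteq> I" "I \<subseteq> {a..b}" "measure lebesgue I = b - a"
    using bounded_intervals_halfline_bounds[OF I] .
  then show "set_integrable lebesgue I (\<lambda>x. x powr (1 / c - 1))"
    using set_integrable_subset[OF set_integrable_powr_Icc[OF assms, of a b]] bounded_interval_sets[OF I] by auto
qed auto

text \<open>The infimum over an interval from \<open>a\<close> to \<open>b\<close> is the value at \<open>b\<close>, and for fixed \<open>b\<close> the average
  of a decreasing function is largest at \<open>a = 0\<close>.\<close>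

lemma A1_bound_powr:
  assumes c: "1 < c"
  shows "A1_bound {0<..} (\<lambda>x. x powr (1 / c - 1)) c"
proof (rule A1_boundI[OF weight_on_halfline_powr])
  let ?v = "\<lambda>x. x powr (1 / c - 1)"
  fix I x assume I: "I \<in> bounded_intervals {0<..}" and x: "x \<in> I"
  obtain a b where ab: "0 \<le> a" "a < b" "{a<..<b} \<subseteq> I" "I \<subseteq> {a..b}" "measure lebesgue I = b - a"
    using bounded_intervals_halfline_bounds[OF I] .
  have v: "weight_on {0<..} ?v" using c by (intro weight_on_halfline_powr) auto
  have Icc: "set_integrable lebesgue {a..b} ?v" using ab c by (intro set_integrable_powr_Icc) auto
  have "(LINT x:I|lebesgue. ?v x) \<le> (LINT x:{a..b}|lebesgue. ?v x)"
    unfolding set_lebesgue_integral_def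
    using weight_integrable[OF v I] Icc ab(4)
    by (intro integral_mono) (auto simp: set_integrable_def split: split_indicator)
  also have "\<dots> = c * (b powr (1 / c) - a powr (1 / c))"
    using has_integral_powr_Icc[of c a b] c ab
    by (simp add: set_lebesgue_integral_eq_integral(2)[OF Icc] integral_unique right_diff_distrib)
  also have "\<dots> \<le> c * (b powr (1 / c - 1) * (b - a))"
  proof -
    have "a * b powr (1 / c - 1) \<le> a powr (1 / c)"
    proof (cases "a = 0")
      case False
      then have "b powr (1 / c - 1) \<le> a powr (1 / c - 1)"
        using ab c by (intro powr_mono2') auto
      then have "a * b powr (1 / c - 1) \<le> a * a powr (1 / c - 1)"
        using ab by (intro mult_left_mono) auto
      then show ?thesis using powr_mult_base[of a "1 / c - 1"] ab by simp
    qed simp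
    moreover have "b * b powr (1 / c - 1) = b powr (1 / c)"
      using powr_mult_base[of b "1 / c - 1"] ab by simp
    ultimately show ?thesis using c by (intro mult_left_mono) (auto simp: algebra_simps)
  qed
  finally have "average I ?v \<le> c * b powr (1 / c - 1)"
    using ab by (simp add: average_def divide_le_eq mult.assoc)
  also have "\<dots> \<le> c * x powr (1 / c - 1)"
    using c x ab(4) I by (intro mult_left_mono powr_mono2') (auto simp: bounded_intervals_def)
  finally show "average I ?v \<le> c * x powr (1 / c - 1)" .
qed (use c in auto)

text \<open>On \<open>(0, 1)\<close> the average is \<open>c\<close> while the weight comes arbitrarily close to \<open>1\<close> near the right
  endpoint.\<close>

lemma A1_bound_powr_sharp:
  assumes c: "1 < c" and A: "A1_bound {0<..} (\<lambda>x. x powr (1 / c - 1)) c'"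
  shows "c \<le> c'"
proof (rule ccontr)
  let ?v = "\<lambda>x. x powr (1 / c - 1)" and ?I = "{0<..<1::real}"
  assume "\<not> c \<le> c'"
  have v: "weight_on {0<..} ?v" using c by (intro weight_on_halfline_powr) auto
  note I = unit_interval_bounded_interval(1)
  have c': "0 < c'" using A1_bound_pos[OF v I A] .
  have avg: "average ?I ?v = c"
  proof -
    have "(?v has_integral c) ?I"
      using has_integral_powr_Icc[of c 0 1] c by (simp add: has_integral_Icc_iff_Ioo)
    then show ?thesis
      using set_lebesgue_integral_eq_integral(2)[OF weight_integrable[OF v I]]
      by (simp add: average_def integral_unique)
  qed
  \<comment> \<open>\<open>d\<close> is where the weight equals \<open>c / c'\<close>; to its right the bound by \<open>c'\<close> fails.\<close>
  define d where "d = (c / c') powr (1 / (1 / c - 1))"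
  have e: "1 / c - 1 < 0" using c by simp
  have d: "0 < d" "d < 1"
  proof -
    have q: "1 < c / c'" using \<open>\<not> c \<le> c'\<close> c' by simp
    show "0 < d" using c c' by (simp add: d_def)
    have "(c / c') powr (1 / (1 / c - 1)) < (c / c') powr 0"
      using q e by (intro powr_less_mono) (auto simp: divide_less_0_iff)
    then show "d < 1" using c c' by (simp add: d_def)
  qed
  have "AE x in lebesgue. x \<notin> {d<..<1}"
    using A1_bound_AE[OF A c' I]
  proof (rule eventually_mono)
    fix x assume x: "x \<in> ?I \<longrightarrow> average ?I ?v \<le> c' * ?v x"
    show "x \<notin> {d<..<1}"
    proof
      assume xd: "x \<in> {d<..<1}"
      then have "?v x < d powr (1 / c - 1)" using d e by (intro powr_less_mono2_neg) auto
      also have "\<dots> = c / c'" using c c' e by (simp add: d_def powr_powr)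
      finally have "c' * ?v x < c" using c' by (simp add: field_simps)
      then show False using x xd d avg by simp
    qed
  qed
  then have "{d<..<1} \<in> null_sets lebesgue" by (subst (asm) AE_iff_null_sets[symmetric]) auto
  then have "measure lebesgue {d<..<1} = 0" by (rule measure_eq_0_null_sets)
  then show False using d by simp
qed

text \<open>The power dominates \<open>1/x\<close>, whose integral over \<open>(\<epsilon>, 1)\<close> is unbounded as \<open>\<epsilon>\<close> decreases.\<close>

lemma not_set_integrable_powr:
  assumes "\<beta> \<le> -1"
  shows "\<not> set_integrable lebesgue {0<..<1} (\<lambda>x::real. x powr \<beta>)"
proof
  assume int: "set_integrable lebesgue {0<..<1} (\<lambda>x::real. x powr \<beta>)"
  define L where "L = (LINT x:{0<..<1}|lebesgue. x powr \<beta>)"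
  \<comment> \<open>Chosen so that \<open>- ln \<epsilon>\<close> exceeds \<open>L\<close>.\<close>
  define \<epsilon> where "\<epsilon> = exp (- (\<bar>L\<bar> + 1))"
  have \<epsilon>: "0 < \<epsilon>" "\<epsilon> < 1" by (auto simp: \<epsilon>_def)
  have "((\<lambda>x. inverse x) has_integral ln 1 - ln \<epsilon>) {\<epsilon>..1}"
    using \<epsilon> by (intro fundamental_theorem_of_calculus)
      (auto simp: has_real_derivative_iff_has_vector_derivative[symmetric] intro!: derivative_eq_intros simp: divide_inverse)
  then have hi: "((\<lambda>x. inverse x) has_integral - ln \<epsilon>) {\<epsilon><..<1}"
    by (simp add: has_integral_Icc_iff_Ioo)
  then have i: "set_integrable lebesgue {\<epsilon><..<1} (\<lambda>x. inverse x)"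
    using \<epsilon> by (intro nonnegative_absolutely_integrable_1) auto
  have "- ln \<epsilon> = (LINT x:{\<epsilon><..<1}|lebesgue. inverse x)"
    using hi by (simp add: set_lebesgue_integral_eq_integral(2)[OF i] integral_unique)
  also have "\<dots> \<le> L"
    unfolding L_def set_lebesgue_integral_def
  proof (rule integral_mono)
    fix x :: real
    have "inverse x \<le> x powr \<beta>" if "0 < x" "x < 1"
      using powr_mono'[of \<beta> "-1" x] assms that by (simp add: powr_minus)
    then show "indicat_real {\<epsilon><..<1} x *\<^sub>R inverse x \<le> indicat_real {0<..<1} x *\<^sub>R x powr \<beta>"
      using \<epsilon> by (auto split: split_indicator)
  qed (use i int in \<open>auto simp: set_integrable_def\<close>)
  finally show False by (simp add: \<epsilon>_def)
qed

text \<open>With \<open>w = v powr (1 / r)\<close>, the function \<open>w\<^sup>p\<close> is a power of \<open>x\<close> whose exponent reaches \<open>-1\<close>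
  exactly at \<open>p = c r / (c - 1)\<close>; from there on it is not even integrable near \<open>0\<close>. Membership in \<open>RH {0<..} r\<close> needs no computation: it is the
  endpoint \<open>p = r\<close> of \<open>RH_of_A1_const\<close>.\<close>

lemma power_weight_extremal:
  fixes r c :: real
  assumes r: "1 < r" and c: "1 < c"
  defines "v \<equiv> \<lambda>x::real. x powr (1 / c - 1)"
  shows "v \<in> A1 {0<..}" and "A1_const {0<..} v = c"
    and "(\<lambda>x. v x powr (1 / r)) \<in> RH {0<..} r"
    and "\<And>p. c * r / (c - 1) \<le> p \<Longrightarrow> (\<lambda>x. v x powr (1 / r)) \<notin> RH {0<..} p"
proof -
  have v: "weight_on {0<..} v" using c weight_on_halfline_powr by (simp add: v_def)
  have A: "A1_bound {0<..} v c" using A1_bound_powr[OF c] by (simp add: v_def)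
  show vA: "v \<in> A1 {0<..}" using v A by (auto simp: A1_def)
  show const: "A1_const {0<..} v = c"
    unfolding A1_const_def using A A1_bound_powr_sharp[OF c] by (intro cInf_eq_minimum) (auto simp: v_def)
  show "(\<lambda>x. v x powr (1 / r)) \<in> RH {0<..} r"
  proof (rule RH_of_A1_const[OF r _ _ RH_infinity_one vA])
    show "A1_const {0<..} v = 1 \<or> r < A1_const {0<..} v * r / (A1_const {0<..} v - 1)"
      using r c by (simp add: const field_simps)
    show "weight_on {0<..} (\<lambda>x. v x powr (1 / r))" using r by (intro weight_on_powr[OF v]) auto
  qed (use unit_interval_bounded_interval in auto)
  fix p assume p: "c * r / (c - 1) \<le> p"
  show "(\<lambda>x. v x powr (1 / r)) \<notin> RH {0<..} p"
  proof
    assume "(\<lambda>x. v x powr (1 / r)) \<in> RH {0<..} p"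
    then have "set_integrable lebesgue {0<..<1} (\<lambda>x. (v x powr (1 / r)) powr p)"
      using unit_interval_bounded_interval by (auto simp: RH_def)
    then have "set_integrable lebesgue {0<..<1} (\<lambda>x. x powr ((1 / c - 1) * p / r))"
      by (simp add: v_def powr_powr)
    moreover have "(1 / c - 1) * p / r \<le> - 1"
    proof -
      have "c * r \<le> p * (c - 1)" using p c by (simp add: field_simps)
      then show ?thesis using c r by (simp add: field_simps)
    qed
    ultimately show False using not_set_integrable_powr by blast
  qed
qed

theorem theorem4:
  fixes r :: real
  assumes "1 < r"
  shows "(\<forall>(u :: real \<Rightarrow> real) (v :: real \<Rightarrow> real) (w :: real \<Rightarrow> real) (c2 :: real).
            w = (\<lambda>x. u x * v x powr (1 / r)) \<and> w \<in> RH UNIV r \<and>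
            u \<in> RH_infinity UNIV \<and> v \<in> A1 UNIV \<and> c2 = A1_const UNIV v \<longrightarrow>
            (\<forall>p. r \<le> p \<and> (c2 = 1 \<or> p < c2 * r / (c2 - 1)) \<longrightarrow> w \<in> RH UNIV p)) \<and>
         (\<forall>c2 > 1. \<exists>(u :: real \<Rightarrow> real) (v :: real \<Rightarrow> real) (w :: real \<Rightarrow> real).
            w = (\<lambda>x. u x * v x powr (1 / r)) \<and> w \<in> RH {0<..} r \<and>
            u \<in> RH_infinity {0<..} \<and> v \<in> A1 {0<..} \<and> A1_const {0<..} v = c2 \<and>
            (\<forall>p \<ge> c2 * r / (c2 - 1). w \<notin> RH {0<..} p))"
proof (intro conjI allI impI)
  fix u v w :: "real \<Rightarrow> real" and c2 p :: real
  assume "w = (\<lambda>x. u x * v x powr (1 / r)) \<and> w \<in> RH UNIV r \<and>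
      u \<in> RH_infinity UNIV \<and> v \<in> A1 UNIV \<and> c2 = A1_const UNIV v"
    and "r \<le> p \<and> (c2 = 1 \<or> p < c2 * r / (c2 - 1))"
  then show "w \<in> RH UNIV p"
    using unit_interval_bounded_interval(2) assms
    by (intro RH_of_A1_const[of r UNIV w u v p]) (auto simp: RH_def)
next
  fix c2 :: real assume "1 < c2"
  note ext = power_weight_extremal[OF assms this]
  show "\<exists>(u :: real \<Rightarrow> real) (v :: real \<Rightarrow> real) (w :: real \<Rightarrow> real).
      w = (\<lambda>x. u x * v x powr (1 / r)) \<and> w \<in> RH {0<..} r \<and>
      u \<in> RH_infinity {0<..} \<and> v \<in> A1 {0<..} \<and> A1_const {0<..} v = c2 \<and>
      (\<forall>p \<ge> c2 * r / (c2 - 1). w \<notin> RH {0<..} p)"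
    using ext RH_infinity_one
    by (intro exI[of _ "\<lambda>x. 1"] exI[of _ "\<lambda>x. x powr (1 / c2 - 1)"]
      exI[of _ "\<lambda>x. (x powr (1 / c2 - 1)) powr (1 / r)"]) auto
qed

end
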